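(* Let $X$ be a complex Banach space, $\alpha>0$, $T\in\mathcal{B}(X)$ a $(C,\alpha)$-bounded operator, and let $\mathfrak f\in A_+^\alpha(\mathbb{T})$ be of spectral synthesis in $A^\alpha(\mathbb{T})$ with respect to $\sigma(T)\cap\mathbb{T}$. Then $$\lim_{n\to\infty}\big\|M_T^\alpha(n)\,\theta_\alpha(\widehat{\mathfrak f})\big\|=0.$$
   Context: For $\gamma\in\mathbb{R}$, $k^\gamma(0)=1$, $k^\gamma(n)=\frac{\gamma(\gamma+1)\cdots(\gamma+n-1)}{n!}$ for $n\ge1$. For $T\in\mathcal{B}(X)$, $\Delta^{-\alpha}\mathcal{T}(n)=\sum_{j=0}^nk^\alpha(n-j)T^j$, $M_T^\alpha(n)=\Delta^{-\alpha}\mathcal{T}(n)/k^{\alpha+1}(n)$; $T$ is $(C,\alpha)$-bounded if $\sup_n\|M_T^\alpha(n)\|<\infty$. For a sequence $f$ on $\mathbb{Z}$: $W_+f(n)=f(n)-f(n+1)$, $W_-f(n)=f(n)-f(n-1)$, $W_\pm^m$ their powers; for $\alpha>0$, $W_+^{-\alpha}f(n)=\sum_{j\ge n}k^\alpha(j-n)f(j)$, $W_-^{-\alpha}f(n)=\sum_{j\le n}k^\alpha(n-j)f(j)$, $W_\pm^\alpha f=W_\pm^mW_\pm^{-(m-\alpha)}f$ with $m=[\alpha]+1$; $W^\alpha f(n)=W_+^\alpha f(n)$ for $n\ge0$, $=W_-^\alpha f(n)$ for $n<0$. $A^\alpha(\mathbb{T})$ is the space of continuous $2\pi$-periodic functions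 $\mathfrak f(t)=\sum_{n\in\mathbb{Z}}\widehat{\mathfrak f}(n)e^{int}$ ($\widehat{\mathfrak f}(n)$ the Fourier coefficients) with $\|\mathfrak f\|_{A^\alpha(\mathbb{T})}=\sum_{n\in\mathbb{Z}}k^{\alpha+1}(|n|)|W^\alpha\widehat{\mathfrak f}(n)|<\infty$; it is a Banach algebra (pointwise product, i.e. convolution of coefficients) with maximal ideal space $\mathbb{T}$. $A_+^\alpha(\mathbb{T})$ is the subalgebra with $\widehat{\mathfrak f}(n)=0$ for $n<0$. For a closed $E\subseteq\mathbb{T}$ (identified with $[0,2\pi)$ via $t\mapsto e^{it}$), $\mathfrak f\in A^\alpha(\mathbb{T})$ is of spectral synthesis with respect to $E$ if for every $\varepsilon>0$ there is $\mathfrak f_\varepsilon\in A^\alpha(\mathbb{T})$ with $\|\mathfrak f-\mathfrak f_\varepsilon\|_{A^\alpha(\mathbb{T})}<\varepsilon$ and $\mathfrak f_\varepsilon=0$ on a neighbourhood of $E$. For $(C,\alpha)$-bounded $T$ and $f$ on $\mathbb{N}_0$ with $\sum_{n\ge0}k^{\alpha+1}(n)|W_+^\alpha f(n)|<\infty$, $\theta_\alpha(f)=\sum_{n=0}^\infty W_+^\alpha f(n)\,\Delta^{-\alpha}\mathcal{T}(n)\in\mathcal{B}(X)$ (norm convergent series); $\theta_\alpha$ is a bounded algebra homomorphism. *)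

theory Defs
  imports "HOL-Analysis.Analysis"
begin

text \<open>A complex Banach space X is a real Banach space together with a bounded real-linear
  operator J (multiplication by i) with J o J = -I, such that the norm is a complex norm,
  i.e. norm ((cos t + i sin t) x) = norm x for all real t.\<close>

definition complex_structure :: "('a::banach \<Rightarrow>\<^sub>L 'a) \<Rightarrow> bool" where
  "complex_structure J \<longleftrightarrow> J o\<^sub>L J = - id_blinfun \<and>
     (\<forall>t x. norm (cos t *\<^sub>R x + sin t *\<^sub>R blinfun_apply J x) = norm x)"

definition cscaleL :: "('a::banach \<Rightarrow>\<^sub>L 'a) \<Rightarrow> complex \<Rightarrow> ('a \<Rightarrow>\<^sub>L 'a) \<Rightarrow> ('a \<Rightarrow>\<^sub>L 'a)" where
  "cscaleL J z A = Re z *\<^sub>R A + Im z *\<^sub>R (J o\<^sub>L A)"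

definition complex_linear_op :: "('a::banach \<Rightarrow>\<^sub>L 'a) \<Rightarrow> ('a \<Rightarrow>\<^sub>L 'a) \<Rightarrow> bool" where
  "complex_linear_op J T \<longleftrightarrow> T o\<^sub>L J = J o\<^sub>L T"

definition op_spectrum :: "('a::banach \<Rightarrow>\<^sub>L 'a) \<Rightarrow> ('a \<Rightarrow>\<^sub>L 'a) \<Rightarrow> complex set" where
  "op_spectrum J T = {z. \<not> (\<exists>S. complex_linear_op J S \<and>
      S o\<^sub>L (cscaleL J z id_blinfun - T) = id_blinfun \<and>
      (cscaleL J z id_blinfun - T) o\<^sub>L S = id_blinfun)}"

definition opow :: "('a::real_normed_vector \<Rightarrow>\<^sub>L 'a) \<Rightarrow> nat \<Rightarrow> ('a \<Rightarrow>\<^sub>L 'a)" where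
  "opow T j = ((\<lambda>S. T o\<^sub>L S) ^^ j) id_blinfun"

definition kc :: "real \<Rightarrow> nat \<Rightarrow> real" where
  "kc \<gamma> n = pochhammer \<gamma> n / fact n"

definition cesaro_sum :: "real \<Rightarrow> ('a::real_normed_vector \<Rightarrow>\<^sub>L 'a) \<Rightarrow> nat \<Rightarrow> ('a \<Rightarrow>\<^sub>L 'a)" where
  "cesaro_sum \<alpha> T n = (\<Sum>j\<le>n. kc \<alpha> (n - j) *\<^sub>R opow T j)"

definition cesaro_mean :: "real \<Rightarrow> ('a::real_normed_vector \<Rightarrow>\<^sub>L 'a) \<Rightarrow> nat \<Rightarrow> ('a \<Rightarrow>\<^sub>L 'a)" where
  "cesaro_mean \<alpha> T n = (1 / kc (\<alpha> + 1) n) *\<^sub>R cesaro_sum \<alpha> T n"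

definition C_bounded :: "real \<Rightarrow> ('a::real_normed_vector \<Rightarrow>\<^sub>L 'a) \<Rightarrow> bool" where
  "C_bounded \<alpha> T \<longleftrightarrow> (\<exists>C. \<forall>n. norm (cesaro_mean \<alpha> T n) \<le> C)"

definition Wp1 :: "(int \<Rightarrow> complex) \<Rightarrow> int \<Rightarrow> complex" where
  "Wp1 f n = f n - f (n + 1)"

definition Wm1 :: "(int \<Rightarrow> complex) \<Rightarrow> int \<Rightarrow> complex" where
  "Wm1 f n = f n - f (n - 1)"

definition Wp_neg :: "real \<Rightarrow> (int \<Rightarrow> complex) \<Rightarrow> int \<Rightarrow> complex" where
  "Wp_neg \<alpha> f n = infsum (\<lambda>j. of_real (kc \<alpha> (nat (j - n))) * f j) {n..}"

definition Wm_neg :: "real \<Rightarrow> (int \<Rightarrow> complex) \<Rightarrow> int \<Rightarrow> complex" where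
  "Wm_neg \<alpha> f n = infsum (\<lambda>j. of_real (kc \<alpha> (nat (n - j))) * f j) {..n}"

definition Wp :: "real \<Rightarrow> (int \<Rightarrow> complex) \<Rightarrow> int \<Rightarrow> complex" where
  "Wp \<alpha> f = (let m = nat (floor \<alpha>) + 1 in (Wp1 ^^ m) (Wp_neg (real m - \<alpha>) f))"

definition Wm :: "real \<Rightarrow> (int \<Rightarrow> complex) \<Rightarrow> int \<Rightarrow> complex" where
  "Wm \<alpha> f = (let m = nat (floor \<alpha>) + 1 in (Wm1 ^^ m) (Wm_neg (real m - \<alpha>) f))"

definition Wfrac :: "real \<Rightarrow> (int \<Rightarrow> complex) \<Rightarrow> int \<Rightarrow> complex" where
  "Wfrac \<alpha> f n = (if n \<ge> 0 then Wp \<alpha> f n else Wm \<alpha> f n)"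

definition fourier_coeff :: "(real \<Rightarrow> complex) \<Rightarrow> int \<Rightarrow> complex" where
  "fourier_coeff g n = (1 / (2 * pi)) * integral {0..2*pi} (\<lambda>t. g t * exp (- \<i> * of_int n * of_real t))"

definition A_norm :: "real \<Rightarrow> (real \<Rightarrow> complex) \<Rightarrow> real" where
  "A_norm \<alpha> g = infsum (\<lambda>n. kc (\<alpha> + 1) (nat \<bar>n\<bar>) * norm (Wfrac \<alpha> (fourier_coeff g) n)) UNIV"

definition A_alpha :: "real \<Rightarrow> (real \<Rightarrow> complex) set" where
  "A_alpha \<alpha> = {g. continuous_on UNIV g \<and> (\<forall>t. g (t + 2 * pi) = g t) \<and>
     (\<forall>t. ((\<lambda>n. fourier_coeff g n * exp (\<i> * of_int n * of_real t)) has_sum g t) UNIV) \<and>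
     (\<lambda>n. kc (\<alpha> + 1) (nat \<bar>n\<bar>) * norm (Wfrac \<alpha> (fourier_coeff g) n)) summable_on UNIV}"

definition A_alpha_plus :: "real \<Rightarrow> (real \<Rightarrow> complex) set" where
  "A_alpha_plus \<alpha> = {g \<in> A_alpha \<alpha>. \<forall>n<0. fourier_coeff g n = 0}"

text \<open>Spectral synthesis w.r.t. a closed subset E of the circle, given via its
  (2pi-periodic) preimage ER = {t. exp(i t) \<in> E} in R.\<close>
definition spectral_synthesis :: "real \<Rightarrow> (real \<Rightarrow> complex) \<Rightarrow> real set \<Rightarrow> bool" where
  "spectral_synthesis \<alpha> g ER \<longleftrightarrow> (\<forall>\<epsilon>>0. \<exists>h \<in> A_alpha \<alpha>.
      A_norm \<alpha> (\<lambda>t. g t - h t) < \<epsilon> \<and> (\<exists>U. open U \<and> ER \<subseteq> U \<and> (\<forall>t\<in>U. h t = 0)))"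

definition theta :: "('a::banach \<Rightarrow>\<^sub>L 'a) \<Rightarrow> real \<Rightarrow> ('a \<Rightarrow>\<^sub>L 'a) \<Rightarrow> (int \<Rightarrow> complex) \<Rightarrow> ('a \<Rightarrow>\<^sub>L 'a)" where
  "theta J \<alpha> T f = (\<Sum>n. cscaleL J (Wp \<alpha> f (int n)) (cesaro_sum \<alpha> T n))"

end

theory Submission
  imports Defs
begin

text \<open>
  Write \<open>M\<close> for the Cesaro means. Since \<open>M(n) T - M(n + 1) \<longrightarrow> 0\<close>, right multiplication by
  \<open>T\<close> acts on the sequence \<open>M\<close>, modulo null sequences, as the shift, which is an invertible isometry
  there. As the coefficients \<open>f\<close> of a function in \<open>A\<^sup>\<alpha>\<close> are recovered from
  \<open>W\<^sup>\<alpha> f\<close> by an absolutely convergent sum, \<open>M(n) \<theta>(f)\<close> equals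
  \<open>\<Sum>j. f(j) M(n + j)\<close> up to a null sequence, and the latter is bounded by the
  \<open>l\<^sup>1\<close> norm of \<open>f\<close>, hence by the \<open>A\<^sup>\<alpha>\<close> norm. It therefore suffices to treat
  \<open>h\<close> vanishing near the spectrum. Its Abel means are integrals of \<open>h\<close> against the Poisson means
  of \<open>M\<close>, which are \<open>O(1 - r)\<close> modulo null sequences uniformly on the support of \<open>h\<close>,
  because there the resolvent of \<open>T\<close> is bounded across the circle.
\<close>

section \<open>Cesaro numbers and absolutely convergent sums\<close>

text \<open>The approximant \<open>h\<close> supplied by spectral synthesis has coefficients of both
  signs, while \<open>theta\<close> sees only the nonnegative half; hence the passage from
  \<open>theta\<close> to sums over j of f(j) M(n + j), which make sense for every two-sided
  absolutely summable f. Since the powers of \<open>T\<close> may be unbounded, \<open>theta\<close>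
  cannot be expanded in them directly: every exchange of sums goes through the fractional
  differences, whose weight absorbs the growth \<open>kc (\<alpha> + 1) n\<close> of the Cesaro
  sums. Single coefficients do not show where \<open>h\<close> vanishes, so they are written as
  integrals; the sum of exp (- i j t) M(n + j) need not converge, and the factors r^|j| repair this.
  Modulo sequences null at plus infinity, \<open>T\<close> is the shift S, and the Poisson kernel is
  (1 - r^2) times the inverses of 1 - r exp (- i t) S and 1 - r exp (i t) / S. These inverses are
  governed by the resolvent of \<open>T\<close> at exp (i t) / r and r exp (i t), on the two sides
  of the circle. The quotient space is never formed: its null sequences are carried along as
  explicit error terms.\<close>

lemma kc_nonneg: "0 \<le> \<gamma> \<Longrightarrow> 0 \<le> kc \<gamma> n"
  by (simp add: kc_def pochhammer_prod prod_nonneg)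

lemma kc_pos: "0 < \<gamma> \<Longrightarrow> 0 < kc \<gamma> n"
  by (simp add: kc_def pochhammer_pos)

lemma kc_zero_left: "kc 0 n = (if n = 0 then 1 else 0)"
  by (simp add: kc_def pochhammer_0_left)

lemma kc_one_left [simp]: "kc 1 n = 1"
  by (simp add: kc_def pochhammer_fact[symmetric])

lemma kc_zero_right [simp]: "kc \<gamma> 0 = 1"
  by (simp add: kc_def)

lemma kc_Suc: "kc \<gamma> (Suc n) = kc \<gamma> n * ((\<gamma> + n) / (n + 1))"
  by (simp add: kc_def pochhammer_Suc divide_simps)

lemma kc_mono_left:
  assumes "0 \<le> a" "a \<le> b"
  shows "kc a n \<le> kc b n"
  using assms unfolding kc_def pochhammer_prod
  by (intro divide_right_mono prod_mono) auto

lemma kc_le_one: "0 \<le> a \<Longrightarrow> a \<le> 1 \<Longrightarrow> kc a n \<le> 1"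
  using kc_mono_left[of a 1 n] by simp

lemma kc_mono_right:
  assumes "1 \<le> \<gamma>" "m \<le> n"
  shows "kc \<gamma> m \<le> kc \<gamma> n"
proof -
  have "kc \<gamma> n \<le> kc \<gamma> (Suc n)" for n
  proof -
    have "kc \<gamma> n * 1 \<le> kc \<gamma> n * ((\<gamma> + n) / (n + 1))"
      using assms by (intro mult_left_mono kc_nonneg) auto
    then show ?thesis by (simp add: kc_Suc)
  qed
  then show ?thesis using assms(2) by (rule lift_Suc_mono_le)
qed

text \<open>The \<open>kc a\<close> are the Taylor coefficients of (1 - x)^(-a), and these powers
  multiply by adding exponents; in terms of \<open>pochhammer\<close> this is the Vandermonde
  identity.\<close>

lemma kc_convolution: "(\<Sum>i\<le>n. kc a i * kc b (n - i)) = kc (a + b) n"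
  unfolding kc_def pochhammer_binomial_sum sum_divide_distrib
  by (intro sum.cong refl) (simp add: binomial_fact)

lemma sum_kc: "(\<Sum>i\<le>n. kc a (n - i)) = kc (a + 1) n"
  using kc_convolution[of 1 a n] by (simp add: add.commute)

text \<open>Peeling the first factor off \<open>pochhammer \<alpha>\<close> and the last one off
  \<open>pochhammer (\<alpha> + 1)\<close> leaves the same product. The ratio is the weight of the
  identity in the mean of index \<open>Suc n\<close>, hence the O(1/n) error of the shift.\<close>

lemma kc_shift: "kc \<alpha> (Suc n) / kc (\<alpha> + 1) (Suc n) = \<alpha> / (\<alpha> + n + 1)"
  if "0 < \<alpha>"
proof -
  have "kc (\<alpha> + 1) (Suc n) * \<alpha> = kc \<alpha> (Suc n) * (\<alpha> + n + 1)"
    unfolding kc_def pochhammer_rec[of \<alpha>] pochhammer_Suc[of "\<alpha> + 1"] by simp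
  then show ?thesis
    using that kc_pos[of "\<alpha> + 1" "Suc n"] by (simp add: field_simps)
qed

text \<open>Fubini under the bijection between (i, j) and (i + j, j). The hypothesis is stated on
  the diagonals because there the coefficients \<open>kc\<close> convolve, so absolute summability
  can be read off in closed form.\<close>

lemma
  fixes F :: "nat \<Rightarrow> nat \<Rightarrow> 'b::banach"
  assumes "(\<lambda>k. \<Sum>j\<le>k. norm (F (k - j) j)) summable_on UNIV"
  shows summable_triangle_row: "\<And>j. (\<lambda>i. norm (F i j)) summable_on UNIV"
    and summable_triangle_rows: "(\<lambda>j. \<Sum>\<^sub>\<infinity>i. norm (F i j)) summable_on UNIV"
    and infsum_triangle: "(\<Sum>\<^sub>\<infinity>k. \<Sum>j\<le>k. F (k - j) j) = (\<Sum>\<^sub>\<infinity>j. \<Sum>\<^sub>\<infinity>i. F i j)"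
proof -
  define G where "G = (\<lambda>(k, j). F (k - j) j)"
  have "(\<lambda>k. norm (\<Sum>\<^sub>\<infinity>j\<in>{..k}. norm (G (k, j)))) summable_on UNIV"
    using assms by (simp add: G_def sum_nonneg)
  then have G: "(\<lambda>x. norm (G x)) summable_on Sigma UNIV (\<lambda>k. {..k})"
    by (subst Infinite_Sum.abs_summable_on_Sigma_iff) auto
  have abs: "(\<lambda>p. norm ((\<lambda>(j, i). F i j) p)) summable_on UNIV \<times> UNIV"
    by (rule iffD1[OF summable_on_reindex_bij_witness[where j = "\<lambda>(k, j). (j, k - j)" and i = "\<lambda>(j, i). (i + j, j)"] G])
      (auto simp: G_def)
  note rows = iffD1[OF Infinite_Sum.abs_summable_on_Sigma_iff abs, simplified]
  show "(\<lambda>i. norm (F i j)) summable_on UNIV" for j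
    using rows by blast
  show "(\<lambda>j. \<Sum>\<^sub>\<infinity>i. norm (F i j)) summable_on UNIV"
    using rows by (simp add: infsum_nonneg)
  have "(\<Sum>\<^sub>\<infinity>k. \<Sum>j\<le>k. F (k - j) j) = (\<Sum>\<^sub>\<infinity>k. \<Sum>\<^sub>\<infinity>j\<in>{..k}. G (k, j))"
    by (simp add: G_def)
  also have "\<dots> = infsum G (Sigma UNIV (\<lambda>k. {..k}))"
    by (rule infsum_Sigma_banach[OF abs_summable_summable[OF G]])
  also have "\<dots> = infsum (\<lambda>(j, i). F i j) (UNIV \<times> UNIV)"
    by (rule infsum_reindex_bij_witness[where j = "\<lambda>(k, j). (j, k - j)" and i = "\<lambda>(j, i). (i + j, j)"])
      (auto simp: G_def)
  also have "\<dots> = (\<Sum>\<^sub>\<infinity>j. \<Sum>\<^sub>\<infinity>i. F i j)"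
    by (rule infsum_Sigma'_banach[symmetric]) (use abs_summable_summable[OF abs] in simp)
  finally show "(\<Sum>\<^sub>\<infinity>k. \<Sum>j\<le>k. F (k - j) j) = (\<Sum>\<^sub>\<infinity>j. \<Sum>\<^sub>\<infinity>i. F i j)" .
qed

text \<open>Dominated convergence for unordered sums: the M-test makes the finite partial sums
  converge uniformly in the parameter, so the two limits may be exchanged.\<close>

lemma tendsto_infsum_dominated:
  fixes a :: "'i \<Rightarrow> 'n \<Rightarrow> 'b::banach"
  assumes lim: "\<And>i. i \<in> X \<Longrightarrow> ((\<lambda>n. a i n) \<longlongrightarrow> b i) F"
    and bound: "\<And>i n. i \<in> X \<Longrightarrow> norm (a i n) \<le> M i" and M: "M summable_on X"
    and F: "F \<noteq> bot"
  shows "((\<lambda>n. \<Sum>\<^sub>\<infinity>i\<in>X. a i n) \<longlongrightarrow> (\<Sum>\<^sub>\<infinity>i\<in>X. b i)) F"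
proof (rule swap_uniform_limit'[where S = UNIV])
  show "uniform_limit UNIV (\<lambda>Y n. \<Sum>i\<in>Y. a i n) (\<lambda>n. \<Sum>\<^sub>\<infinity>i\<in>X. a i n) (finite_subsets_at_top X)"
    by (rule Weierstrass_m_test_general[OF bound M])
  show "\<forall>\<^sub>F Y in finite_subsets_at_top X. ((\<lambda>n. \<Sum>i\<in>Y. a i n) \<longlongrightarrow> (\<Sum>i\<in>Y. b i)) F"
    by (rule eventually_finite_subsets_at_top_weakI) (auto intro!: tendsto_sum lim)
  have "norm (b i) \<le> M i" if "i \<in> X" for i
    by (rule tendsto_upperbound[OF tendsto_norm[OF lim[OF that]]]) (use bound that F in auto)
  then have "(\<lambda>i. norm (b i)) summable_on X"
    by (intro summable_on_comparison_test[OF M]) auto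
  then show "((\<lambda>Y. \<Sum>i\<in>Y. b i) \<longlongrightarrow> (\<Sum>\<^sub>\<infinity>i\<in>X. b i)) (finite_subsets_at_top X)"
    by (rule infsum_tendsto[OF abs_summable_summable])
qed auto

section \<open>Weyl sums and their inversion\<close>

text \<open>The Weyl sum on a half-line indexed by \<open>nat\<close>; after a reflection it serves
  both \<open>Wp_neg\<close> on nonnegative and \<open>Wm_neg\<close> on negative indices.\<close>

definition weyl_sum :: "real \<Rightarrow> (nat \<Rightarrow> complex) \<Rightarrow> nat \<Rightarrow> complex" where
  "weyl_sum a u n = (\<Sum>\<^sub>\<infinity>k. of_real (kc a k) * u (n + k))"

definition fdiff :: "(nat \<Rightarrow> complex) \<Rightarrow> nat \<Rightarrow> complex" where
  "fdiff u n = u n - u (Suc n)"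

lemma weyl_sum_zero: "weyl_sum 0 u = u"
proof
  fix n
  have "weyl_sum 0 u n = (\<Sum>\<^sub>\<infinity>k\<in>{0}. of_real (kc 0 k) * u (n + k))"
    unfolding weyl_sum_def by (rule infsum_cong_neutral) (auto simp: kc_zero_left)
  then show "weyl_sum 0 u n = u n" by simp
qed

text \<open>The double sum has constant argument \<open>n + j + i\<close> along diagonals, where its
  coefficients collapse to \<open>kc (a + b)\<close>. The weight in the assumption is therefore
  exactly absolute summability of the double sum.\<close>

lemma
  assumes "0 \<le> a" "0 \<le> b" and summ: "(\<lambda>k. kc (a + b) k * norm (u (n + k))) summable_on UNIV"
  shows weyl_sum_add: "weyl_sum a (weyl_sum b u) n = weyl_sum (a + b) u n"
    and abs_summable_weyl_sum: "(\<lambda>k. kc a k * norm (weyl_sum b u (n + k))) summable_on UNIV"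
proof -
  define F where "F = (\<lambda>i j. of_real (kc a j * kc b i) * u (n + j + i))"
  have F: "(\<Sum>j\<le>k. norm (F (k - j) j)) = kc (a + b) k * norm (u (n + k))" for k
    using assms(1,2)
    by (simp add: F_def kc_convolution[symmetric] norm_mult kc_nonneg sum_distrib_right cong: sum.cong_simp)
  have F': "(\<Sum>j\<le>k. F (k - j) j) = of_real (kc (a + b) k) * u (n + k)" for k
    by (simp add: F_def kc_convolution[symmetric] sum_distrib_right cong: sum.cong_simp)
  have row: "(\<Sum>\<^sub>\<infinity>i. F i j) = of_real (kc a j) * weyl_sum b u (n + j)" for j
    by (simp add: F_def weyl_sum_def infsum_cmult_right' mult.assoc)
  show "weyl_sum a (weyl_sum b u) n = weyl_sum (a + b) u n"
    using infsum_triangle[of F] summ by (simp add: F F' row weyl_sum_def[of a] weyl_sum_def[of "a + b"])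
  have F_summ: "(\<lambda>k. \<Sum>j\<le>k. norm (F (k - j) j)) summable_on UNIV"
    using summ by (simp add: F)
  have "(\<lambda>j. norm (\<Sum>\<^sub>\<infinity>i. F i j)) summable_on UNIV"
    by (rule summable_on_comparison_test[OF summable_triangle_rows[OF F_summ]])
       (auto intro: norm_infsum_bound summable_triangle_row[OF F_summ])
  then show "(\<lambda>k. kc a k * norm (weyl_sum b u (n + k))) summable_on UNIV"
    using assms by (simp add: row norm_mult kc_nonneg)
qed

lemma summable_on_shift:
  fixes v :: "nat \<Rightarrow> real"
  assumes "v summable_on UNIV"
  shows "(\<lambda>k. v (n + k)) summable_on UNIV"
proof -
  have "v summable_on range ((+) n)"
    using assms by (rule summable_on_subset_banach) simp
  then show ?thesis
    by (subst (asm) summable_on_reindex) (auto simp: o_def)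
qed

lemma infsum_tail_tendsto_0:
  fixes v :: "nat \<Rightarrow> real"
  assumes "v summable_on UNIV"
  shows "(\<lambda>n. \<Sum>\<^sub>\<infinity>k. v (n + k)) \<longlonglongrightarrow> 0"
proof -
  have "(\<Sum>\<^sub>\<infinity>k. v (n + k)) = (\<Sum>k. v (k + n))" for n
    using has_sum_imp_sums[OF has_sum_infsum[OF summable_on_shift[OF assms, of n]]]
    by (simp add: sums_iff add.commute)
  moreover have "(\<lambda>n. \<Sum>k. v (k + n)) \<longlonglongrightarrow> 0"
    by (rule suminf_exist_split2[OF summable_on_imp_summable[OF assms]])
  ultimately show ?thesis by simp
qed

lemma weyl_sum_one_fdiff:
  assumes "(\<lambda>k. norm (fdiff u (n + k))) summable_on UNIV" "u \<longlonglongrightarrow> 0"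
  shows "weyl_sum 1 (fdiff u) n = u n"
proof -
  have "(\<lambda>k. fdiff u (n + k)) sums weyl_sum 1 (fdiff u) n"
    unfolding weyl_sum_def using abs_summable_summable[OF assms(1)]
    by (intro has_sum_imp_sums) simp
  moreover have "(\<lambda>k. u (n + k) - u (n + Suc k)) sums (u (n + 0) - 0)"
    by (rule telescope_sums') (use LIMSEQ_ignore_initial_segment[OF assms(2), of n] in \<open>simp add: add.commute\<close>)
  ultimately show ?thesis
    by (simp add: fdiff_def sums_iff)
qed

lemma fdiff_weyl_sum_one:
  assumes "(\<lambda>k. norm (u k)) summable_on UNIV"
  shows "fdiff (weyl_sum 1 u) n = u n"
proof -
  have s: "(\<lambda>k. u (m + k)) sums weyl_sum 1 u m" for m
    unfolding weyl_sum_def using abs_summable_summable[OF summable_on_shift[OF assms, of m]]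
    by (intro has_sum_imp_sums) simp
  have "(\<lambda>k. u (n + Suc k)) sums (weyl_sum 1 u n - u n)"
    using s[of n] by (subst sums_Suc_iff) simp
  with s[of "Suc n"] have "weyl_sum 1 u (Suc n) = weyl_sum 1 u n - u n"
    by (simp add: sums_iff)
  then show ?thesis by (simp add: fdiff_def)
qed

lemma fdiff_tendsto_0: "u \<longlonglongrightarrow> 0 \<Longrightarrow> fdiff u \<longlonglongrightarrow> 0"
  unfolding fdiff_def using tendsto_diff[OF _ LIMSEQ_Suc, of u 0 u 0] by simp

lemma kc_weighted_summable_shift:
  assumes "1 \<le> \<gamma>" "(\<lambda>k. kc \<gamma> k * norm (u k)) summable_on UNIV"
  shows "(\<lambda>k. kc \<gamma> k * norm (u (n + k :: nat))) summable_on UNIV"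
  by (rule summable_on_comparison_test[OF summable_on_shift[OF assms(2), of n]])
     (use assms(1) in \<open>auto intro!: mult_right_mono kc_mono_right mult_nonneg_nonneg kc_nonneg\<close>)

text \<open>Summing undoes differencing one order at a time. The decay of \<open>u\<close> fixes the
  constant of summation at each level, and it passes on to \<open>fdiff u\<close>, to which the
  induction hypothesis is applied.\<close>

lemma weyl_sum_fdiff_funpow:
  assumes "u \<longlonglongrightarrow> 0" and "(\<lambda>k. kc m k * norm ((fdiff ^^ m) u k)) summable_on UNIV"
  shows "weyl_sum m ((fdiff ^^ m) u) n = u n"
  using assms
proof (induction m arbitrary: u n)
  case 0
  then show ?case by (simp add: weyl_sum_zero)
next
  case (Suc m)
  let ?g = "(fdiff ^^ Suc m) u"
  have g: "?g = (fdiff ^^ m) (fdiff u)" by (simp only: funpow_Suc_right o_apply)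
  have "(\<lambda>k. kc m k * norm (?g k)) summable_on UNIV"
    by (rule summable_on_comparison_test[OF Suc.prems(2)])
       (auto intro!: mult_right_mono kc_mono_left mult_nonneg_nonneg kc_nonneg)
  then have IH: "weyl_sum m ?g n = fdiff u n" for n
    unfolding g by (intro Suc.IH fdiff_tendsto_0 Suc.prems(1))
  have sh: "(\<lambda>k. kc (1 + real m) k * norm (?g (n + k))) summable_on UNIV"
    using Suc.prems(2) kc_weighted_summable_shift[of "1 + real m" ?g n] by simp
  have "(\<lambda>k. kc 1 k * norm (weyl_sum m ?g (n + k))) summable_on UNIV"
    by (rule abs_summable_weyl_sum) (use sh in auto)
  then have "weyl_sum 1 (fdiff u) n = u n"
    by (intro weyl_sum_one_fdiff Suc.prems(1)) (simp add: IH del: funpow.simps)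
  moreover have "weyl_sum 1 (weyl_sum m ?g) n = weyl_sum (1 + real m) ?g n"
    by (rule weyl_sum_add) (use sh in auto)
  moreover have "weyl_sum m ?g = fdiff u" using IH by auto
  ultimately show ?case by simp
qed

text \<open>For orders in [0, 1] the coefficients are at most 1, so the Weyl sum at \<open>n\<close>
  is dominated by the tail of an absolutely convergent series.\<close>

lemma weyl_sum_tendsto_0:
  assumes "0 \<le> b" "b \<le> 1" and u: "(\<lambda>k. norm (u k)) summable_on UNIV"
  shows "weyl_sum b u \<longlonglongrightarrow> 0"
proof (rule Lim_null_comparison[OF _ infsum_tail_tendsto_0[OF u]], rule always_eventually, rule allI)
  fix n
  have le: "norm (of_real (kc b k) * u (n + k)) \<le> norm (u (n + k))" for k
    using assms kc_le_one[of b k] kc_nonneg[of b k] by (simp add: norm_mult mult_left_le_one_le)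
  have "(\<lambda>k. norm (of_real (kc b k) * u (n + k))) summable_on UNIV"
    by (rule summable_on_comparison_test[OF summable_on_shift[OF u, of n]]) (use le in auto)
  then show "norm (weyl_sum b u n) \<le> (\<Sum>\<^sub>\<infinity>k. norm (u (n + k)))"
    unfolding weyl_sum_def
    by (rule norm_infsum_le[OF has_sum_infsum[OF abs_summable_summable] has_sum_infsum[OF summable_on_shift[OF u]] le])
qed

text \<open>Put \<open>b = m - \<alpha>\<close>. The Weyl sums of order \<open>b\<close> of \<open>u\<close> and of
  \<open>weyl_sum \<alpha> g\<close> are null sequences with the same \<open>m\<close>-th difference, so they agree;
  a further Weyl sum of order \<open>1 - b\<close> followed by \<open>fdiff\<close> undoes the one of order \<open>b\<close>.\<close>
lemma weyl_sum_inversion: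
  fixes m :: nat
  assumes "0 < \<alpha>" "0 < real m - \<alpha>" "real m - \<alpha> \<le> 1"
    and u: "(\<lambda>k. norm (u k)) summable_on UNIV"
    and g: "g = (fdiff ^^ m) (weyl_sum (real m - \<alpha>) u)"
    and summ: "(\<lambda>k. kc (\<alpha> + 1) k * norm (g k)) summable_on UNIV"
  shows "weyl_sum \<alpha> g n = u n"
proof -
  define b where "b = real m - \<alpha>"
  have b: "0 \<le> b" "b \<le> 1" "b + \<alpha> = real m" using assms by (auto simp: b_def)
  have sh: "(\<lambda>k. kc (\<alpha> + 1) k * norm (g (n + k))) summable_on UNIV" for n
    using summ by (rule kc_weighted_summable_shift[rotated]) (use assms in simp)
  have shm: "(\<lambda>k. kc (b + \<alpha>) k * norm (g (n + k))) summable_on UNIV" for n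
    by (rule summable_on_comparison_test[OF sh[of n]])
       (use b assms in \<open>auto intro!: mult_right_mono kc_mono_left mult_nonneg_nonneg kc_nonneg\<close>)
  have w: "(\<lambda>k. norm (weyl_sum \<alpha> g k)) summable_on UNIV"
    using abs_summable_weyl_sum[of 1 \<alpha> g 0] sh[of 0] assms by (simp add: add.commute)
  have "weyl_sum m g n = weyl_sum b u n" for n
    unfolding g b_def[symmetric]
    by (rule weyl_sum_fdiff_funpow) (use b u shm[of 0] in \<open>auto intro: weyl_sum_tendsto_0 simp: g b_def[symmetric]\<close>)
  then have eq: "weyl_sum b (weyl_sum \<alpha> g) = weyl_sum b u"
    using weyl_sum_add[OF _ _ shm] b assms by auto
  have "weyl_sum 1 v n = weyl_sum (1 - b) (weyl_sum b v) n" if "(\<lambda>k. norm (v k)) summable_on UNIV" for v n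
    using weyl_sum_add[of "1 - b" b v n] b summable_on_shift[OF that, of n] by simp
  then have "weyl_sum 1 (weyl_sum \<alpha> g) = weyl_sum 1 u"
    using u w eq by auto
  then show ?thesis
    using fdiff_weyl_sum_one[OF u, of n] fdiff_weyl_sum_one[OF w, of n] by simp
qed

section \<open>Fractional differences on the two half-lines of the integers\<close>

lemma Wp1_funpow_nat: "(Wp1 ^^ m) F (int n) = (fdiff ^^ m) (\<lambda>k. F (int k)) n"
proof (induction m arbitrary: n)
  case (Suc m)
  show ?case
    using Suc[of n] Suc[of "Suc n"]
    by (simp add: Wp1_def[of "(Wp1 ^^ m) F"] fdiff_def[of "(fdiff ^^ m) (\<lambda>k. F (int k))"] add.commute)
qed simp

text \<open>The reflection n to -1 - n maps the negative integers onto \<open>nat\<close> and turns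
  backward into forward differences, so the half-line theory applies to both signs.\<close>

lemma Wm1_funpow_nat: "(Wm1 ^^ m) F (- 1 - int n) = (fdiff ^^ m) (\<lambda>k. F (- 1 - int k)) n"
proof (induction m arbitrary: n)
  case (Suc m)
  show ?case
    using Suc[of n] Suc[of "Suc n"]
    by (simp add: Wm1_def[of "(Wm1 ^^ m) F"] fdiff_def[of "(fdiff ^^ m) (\<lambda>k. F (- 1 - int k))"])
qed simp

lemma Wp_neg_nat: "Wp_neg a f (int n) = weyl_sum a (\<lambda>k. f (int k)) n"
  unfolding Wp_neg_def weyl_sum_def
  by (rule infsum_reindex_bij_witness[where i = "\<lambda>k. int (n + k)" and j = "\<lambda>j. nat (j - int n)"])
     auto

lemma Wm_neg_nat: "Wm_neg a f (- 1 - int n) = weyl_sum a (\<lambda>k. f (- 1 - int k)) n"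
  unfolding Wm_neg_def weyl_sum_def
  by (rule infsum_reindex_bij_witness[where i = "\<lambda>k. - 1 - int (n + k)" and j = "\<lambda>j. nat (- 1 - int n - j)"])
     auto

definition weyl_diff :: "real \<Rightarrow> (nat \<Rightarrow> complex) \<Rightarrow> nat \<Rightarrow> complex" where
  "weyl_diff \<alpha> u = (let m = nat \<lfloor>\<alpha>\<rfloor> + 1 in (fdiff ^^ m) (weyl_sum (real m - \<alpha>) u))"

lemma Wp_nat: "Wp \<alpha> f (int n) = weyl_diff \<alpha> (\<lambda>k. f (int k)) n"
  by (simp only: Wp_def weyl_diff_def Let_def Wp1_funpow_nat Wp_neg_nat)

lemma Wm_nat: "Wm \<alpha> f (- 1 - int n) = weyl_diff \<alpha> (\<lambda>k. f (- 1 - int k)) n"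
  by (simp only: Wm_def weyl_diff_def Let_def Wm1_funpow_nat Wm_neg_nat)

lemma weyl_order_bounds:
  assumes "0 < \<alpha>"
  shows "0 < real (nat \<lfloor>\<alpha>\<rfloor> + 1) - \<alpha>" "real (nat \<lfloor>\<alpha>\<rfloor> + 1) - \<alpha> \<le> 1"
  using assms by linarith+

lemma weyl_sum_weyl_diff:
  assumes "0 < \<alpha>" "(\<lambda>k. norm (u k)) summable_on UNIV"
    "(\<lambda>k. kc (\<alpha> + 1) k * norm (weyl_diff \<alpha> u k)) summable_on UNIV"
  shows "weyl_sum \<alpha> (weyl_diff \<alpha> u) n = u n"
  by (rule weyl_sum_inversion[OF assms(1) weyl_order_bounds[OF assms(1)] assms(2) _ assms(3)])
     (simp add: weyl_diff_def Let_def)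

text \<open>Divergent sums take the default value 0, so linearity is not automatic. Coefficients
  bounded by 1 let absolute summability of \<open>u\<close> and \<open>v\<close> suffice.\<close>

lemma weyl_sum_diff:
  assumes "0 \<le> a" "a \<le> 1" "(\<lambda>k. norm (u k)) summable_on UNIV" "(\<lambda>k. norm (v k)) summable_on UNIV"
  shows "weyl_sum a (\<lambda>k. u k - v k) n = weyl_sum a u n - weyl_sum a v n"
proof -
  have summ: "(\<lambda>k. of_real (kc a k) * w (n + k)) summable_on UNIV"
    if "(\<lambda>k. norm (w k)) summable_on UNIV" for w :: "nat \<Rightarrow> complex"
  proof (rule abs_summable_summable, rule summable_on_comparison_test[OF summable_on_shift[OF that, of n]])
    show "norm (of_real (kc a k) * w (n + k)) \<le> norm (w (n + k))" for k
      using assms kc_le_one[of a k] kc_nonneg[of a k] by (simp add: norm_mult mult_left_le_one_le)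
  qed auto
  have "((\<lambda>k. of_real (kc a k) * u (n + k) + - (of_real (kc a k) * v (n + k))) has_sum
      weyl_sum a u n + - weyl_sum a v n) UNIV"
    unfolding weyl_sum_def
    by (intro has_sum_add has_sum_uminus[THEN iffD2]) (use summ assms in auto)
  then show ?thesis
    unfolding weyl_sum_def by (intro infsumI) (simp add: algebra_simps)
qed

lemma fdiff_funpow_diff: "(fdiff ^^ m) (\<lambda>k. u k - v k) n = (fdiff ^^ m) u n - (fdiff ^^ m) v n"
  by (induction m arbitrary: n) (simp_all add: fdiff_def)

lemma weyl_diff_diff:
  assumes "0 < \<alpha>" "(\<lambda>k. norm (u k)) summable_on UNIV" "(\<lambda>k. norm (v k)) summable_on UNIV"
  shows "weyl_diff \<alpha> (\<lambda>k. u k - v k) n = weyl_diff \<alpha> u n - weyl_diff \<alpha> v n"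
proof -
  have "weyl_sum (real (nat \<lfloor>\<alpha>\<rfloor> + 1) - \<alpha>) (\<lambda>k. u k - v k) =
    (\<lambda>n. weyl_sum (real (nat \<lfloor>\<alpha>\<rfloor> + 1) - \<alpha>) u n - weyl_sum (real (nat \<lfloor>\<alpha>\<rfloor> + 1) - \<alpha>) v n)"
    using weyl_sum_diff[OF _ _ assms(2,3)] weyl_order_bounds[OF assms(1)] by auto
  then show ?thesis
    unfolding weyl_diff_def Let_def by (simp only: fdiff_funpow_diff)
qed

text \<open>After exchanging the sums, the term \<open>g k\<close> is hit by all
  \<open>kc \<alpha> i\<close> with i \<le> k, whose sum is \<open>kc (\<alpha> + 1) k\<close>. This
  is the origin of the weight in the norm.\<close>

lemma weyl_sum_l1_bound:
  assumes "0 < \<alpha>" and summ: "(\<lambda>k. kc (\<alpha> + 1) k * norm (g k)) summable_on UNIV"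
  shows "(\<Sum>\<^sub>\<infinity>j. norm (weyl_sum \<alpha> g j)) \<le> (\<Sum>\<^sub>\<infinity>k. kc (\<alpha> + 1) k * norm (g k))"
proof -
  define F where "F = (\<lambda>i j. kc \<alpha> i * norm (g (j + i)))"
  have nn: "0 \<le> F i j" for i j using assms by (simp add: F_def kc_nonneg)
  have F: "(\<Sum>j\<le>k. F (k - j) j) = kc (\<alpha> + 1) k * norm (g k)" for k
    by (simp add: F_def sum_kc[symmetric] sum_distrib_right cong: sum.cong_simp)
  have F_summ: "(\<lambda>k. \<Sum>j\<le>k. norm (F (k - j) j)) summable_on UNIV"
    using summ by (simp add: F nn)
  have le: "norm (weyl_sum \<alpha> g j) \<le> (\<Sum>\<^sub>\<infinity>i. F i j)" for j
  proof -
    have n: "norm (of_real (kc \<alpha> k) * g (j + k)) = F k j" for k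
      using assms by (simp add: F_def norm_mult kc_nonneg)
    have "(\<lambda>k. norm (of_real (kc \<alpha> k) * g (j + k))) summable_on UNIV"
      unfolding n using summable_triangle_row[OF F_summ, of j] nn by simp
    from norm_infsum_bound[OF this] show ?thesis
      unfolding n weyl_sum_def .
  qed
  have rows: "(\<lambda>j. \<Sum>\<^sub>\<infinity>i. F i j) summable_on UNIV"
    using summable_triangle_rows[OF F_summ] nn by simp
  have "(\<Sum>\<^sub>\<infinity>j. norm (weyl_sum \<alpha> g j)) \<le> (\<Sum>\<^sub>\<infinity>j. \<Sum>\<^sub>\<infinity>i. F i j)"
    by (rule infsum_mono[OF _ rows]) (use le summable_on_comparison_test[OF rows] in auto)
  also have "\<dots> = (\<Sum>\<^sub>\<infinity>k. kc (\<alpha> + 1) k * norm (g k))"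
    using infsum_triangle[of F] summ by (simp add: F nn)
  finally show "(\<Sum>\<^sub>\<infinity>j. norm (weyl_sum \<alpha> g j)) \<le> (\<Sum>\<^sub>\<infinity>k. kc (\<alpha> + 1) k * norm (g k))" .
qed

lemma
  fixes v :: "int \<Rightarrow> 'b::banach"
  assumes "v summable_on UNIV"
  shows summable_on_int_nonneg: "(\<lambda>n. v (int n)) summable_on UNIV"
    and summable_on_int_neg: "(\<lambda>n. v (- 1 - int n)) summable_on UNIV"
    and infsum_int_split: "infsum v UNIV = (\<Sum>\<^sub>\<infinity>n. v (int n)) + (\<Sum>\<^sub>\<infinity>n. v (- 1 - int n))"
proof -
  have s: "v summable_on {0..}" "v summable_on {..-1}"
    using assms by (auto intro: summable_on_subset_banach)
  show "(\<lambda>n. v (int n)) summable_on UNIV"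
    by (rule iffD1[OF summable_on_reindex_bij_witness[where i = int and j = nat] s(1)]) auto
  show "(\<lambda>n. v (- 1 - int n)) summable_on UNIV"
    by (rule iffD1[OF summable_on_reindex_bij_witness[where i = "\<lambda>n. - 1 - int n" and j = "\<lambda>n. nat (- 1 - n)"] s(2)]) auto
  have "infsum v UNIV = infsum v ({0..} \<union> {..-1})" by (rule arg_cong[where f = "infsum v"]) auto
  also have "\<dots> = infsum v {0..} + infsum v {..-1}"
    using s by (intro infsum_Un_disjoint) auto
  also have "infsum v {0..} = (\<Sum>\<^sub>\<infinity>n. v (int n))"
    by (rule infsum_reindex_bij_witness[where i = int and j = nat]) auto
  also have "infsum v {..-1} = (\<Sum>\<^sub>\<infinity>n. v (- 1 - int n))"
    by (rule infsum_reindex_bij_witness[where i = "\<lambda>n. - 1 - int n" and j = "\<lambda>n. nat (- 1 - n)"]) auto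
  finally show "infsum v UNIV = (\<Sum>\<^sub>\<infinity>n. v (int n)) + (\<Sum>\<^sub>\<infinity>n. v (- 1 - int n))" .
qed

text \<open>On each half-line the sequence is the Weyl sum of its own fractional difference, so the
  bound for Weyl sums applies to both halves separately.\<close>

lemma l1_norm_le_weighted:
  assumes "0 < \<alpha>" and f: "(\<lambda>n. norm (f n)) summable_on UNIV"
    and w: "(\<lambda>n. kc (\<alpha> + 1) (nat \<bar>n\<bar>) * norm (Wfrac \<alpha> f n)) summable_on UNIV"
  shows "(\<Sum>\<^sub>\<infinity>n. norm (f n)) \<le> (\<Sum>\<^sub>\<infinity>n. kc (\<alpha> + 1) (nat \<bar>n\<bar>) * norm (Wfrac \<alpha> f n))"
proof -
  let ?k = "\<lambda>n. kc (\<alpha> + 1) n"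
  let ?p = "\<lambda>k. f (int k)" and ?m = "\<lambda>k. f (- 1 - int k)"
  have Wm: "Wfrac \<alpha> f (- 1 - int n) = weyl_diff \<alpha> ?m n" for n
    by (simp add: Wfrac_def Wm_nat)
  have Wp: "Wfrac \<alpha> f (int n) = weyl_diff \<alpha> ?p n" for n
    by (simp add: Wfrac_def Wp_nat)
  have nat_m: "nat \<bar>- 1 - int n\<bar> = Suc n" for n by simp
  have p: "(\<lambda>n. ?k n * norm (weyl_diff \<alpha> ?p n)) summable_on UNIV"
    using summable_on_int_nonneg[OF w] by (simp add: Wp)
  have m: "(\<lambda>n. ?k (Suc n) * norm (weyl_diff \<alpha> ?m n)) summable_on UNIV"
    using summable_on_int_neg[OF w] by (simp only: Wm nat_m)
  \<comment> \<open>Position \<open>n\<close> of the reflected half-line is the integer -1 - n,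
    whose weight has index \<open>Suc n\<close>; monotonicity of the weight absorbs this shift by
    one.\<close>
  have le: "?k n * norm (weyl_diff \<alpha> ?m n) \<le> ?k (Suc n) * norm (weyl_diff \<alpha> ?m n)" for n
    using assms by (intro mult_right_mono kc_mono_right) auto
  have m': "(\<lambda>n. ?k n * norm (weyl_diff \<alpha> ?m n)) summable_on UNIV"
    by (rule summable_on_comparison_test[OF m le]) (use assms in \<open>auto simp: kc_nonneg\<close>)
  have inv: "weyl_sum \<alpha> (weyl_diff \<alpha> ?p) n = ?p n" "weyl_sum \<alpha> (weyl_diff \<alpha> ?m) n = ?m n" for n
    using summable_on_int_nonneg[OF f] summable_on_int_neg[OF f] p m' assms(1)
    by (auto intro!: weyl_sum_weyl_diff)
  have "(\<Sum>\<^sub>\<infinity>n. norm (f n)) = (\<Sum>\<^sub>\<infinity>n. norm (?p n)) + (\<Sum>\<^sub>\<infinity>n. norm (?m n))"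
    by (rule infsum_int_split[OF f])
  also have "\<dots> \<le> (\<Sum>\<^sub>\<infinity>n. ?k n * norm (weyl_diff \<alpha> ?p n)) + (\<Sum>\<^sub>\<infinity>n. ?k n * norm (weyl_diff \<alpha> ?m n))"
    using weyl_sum_l1_bound[OF assms(1) p] weyl_sum_l1_bound[OF assms(1) m'] by (simp add: inv)
  also have "\<dots> \<le> (\<Sum>\<^sub>\<infinity>n. ?k n * norm (weyl_diff \<alpha> ?p n)) + (\<Sum>\<^sub>\<infinity>n. ?k (Suc n) * norm (weyl_diff \<alpha> ?m n))"
    by (intro add_left_mono infsum_mono m m' le)
  also have "\<dots> = (\<Sum>\<^sub>\<infinity>n. kc (\<alpha> + 1) (nat \<bar>n\<bar>) * norm (Wfrac \<alpha> f n))"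
    unfolding infsum_int_split[OF w] Wm Wp nat_m by simp
  finally show ?thesis .
qed

lemma Wfrac_diff:
  assumes "0 < \<alpha>" "(\<lambda>n. norm (f n)) summable_on UNIV" "(\<lambda>n. norm (g n)) summable_on UNIV"
  shows "Wfrac \<alpha> (\<lambda>n. f n - g n) n = Wfrac \<alpha> f n - Wfrac \<alpha> g n"
proof (cases "n \<ge> 0")
  case True
  then obtain k where n: "n = int k" using nonneg_int_cases by blast
  show ?thesis
    using weyl_diff_diff[OF assms(1) summable_on_int_nonneg[OF assms(2)] summable_on_int_nonneg[OF assms(3)]]
    unfolding n by (simp add: Wfrac_def Wp_nat)
next
  case False
  define k where "k = nat (- 1 - n)"
  have n: "n = - 1 - int k" using False by (simp add: k_def)
  show ?thesis
    using weyl_diff_diff[OF assms(1) summable_on_int_neg[OF assms(2)] summable_on_int_neg[OF assms(3)]]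
    unfolding n by (simp add: Wfrac_def Wm_nat)
qed

text \<open>At t = 0 all exponentials equal 1, so the unordered Fourier expansion sums the
  coefficients themselves, and unordered convergence of complex numbers is absolute.\<close>

lemma A_alpha_fourier_coeff_summable:
  assumes "g \<in> A_alpha \<alpha>"
  shows "(\<lambda>n. norm (fourier_coeff g n)) summable_on UNIV"
proof -
  have "((\<lambda>n. fourier_coeff g n * exp (\<i> * of_int n * of_real 0)) has_sum g 0) UNIV"
    using assms unfolding A_alpha_def by blast
  then have "fourier_coeff g summable_on UNIV"
    using has_sum_imp_summable by fastforce
  then show ?thesis
    by (simp only: summable_on_iff_abs_summable_on_complex)
qed

lemma fourier_coeff_diff:
  assumes "continuous_on UNIV g" "continuous_on UNIV h"
  shows "fourier_coeff (\<lambda>t. g t - h t) n = fourier_coeff g n - fourier_coeff h n"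
proof -
  have "(\<lambda>t. k t * exp (- \<i> * of_int n * of_real t)) integrable_on {0..2*pi}"
    if "continuous_on UNIV k" for k :: "real \<Rightarrow> complex"
    by (rule integrable_continuous_interval)
       (intro continuous_intros continuous_on_subset[OF that], auto)
  then have "integral {0..2*pi} (\<lambda>t. g t * exp (- \<i> * of_int n * of_real t) - h t * exp (- \<i> * of_int n * of_real t))
    = integral {0..2*pi} (\<lambda>t. g t * exp (- \<i> * of_int n * of_real t))
      - integral {0..2*pi} (\<lambda>t. h t * exp (- \<i> * of_int n * of_real t))"
    using assms by (intro integral_diff) auto
  then show ?thesis
    by (simp add: fourier_coeff_def left_diff_distrib right_diff_distrib)
qed

lemma l1_norm_le_A_norm:
  assumes "0 < \<alpha>" and g: "g \<in> A_alpha \<alpha>" and h: "h \<in> A_alpha \<alpha>"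
  shows "(\<Sum>\<^sub>\<infinity>n. norm (fourier_coeff g n - fourier_coeff h n)) \<le> A_norm \<alpha> (\<lambda>t. g t - h t)"
proof -
  note gs = A_alpha_fourier_coeff_summable[OF g] and hs = A_alpha_fourier_coeff_summable[OF h]
  let ?k = "\<lambda>n. kc (\<alpha> + 1) (nat \<bar>n\<bar>)"
  let ?f = "\<lambda>n. fourier_coeff g n - fourier_coeff h n"
  have fc: "fourier_coeff (\<lambda>t. g t - h t) = ?f"
    using g h by (intro ext fourier_coeff_diff) (auto simp: A_alpha_def)
  have f: "(\<lambda>n. norm (?f n)) summable_on UNIV"
    by (rule summable_on_comparison_test[OF summable_on_add[OF gs hs]]) (auto intro: norm_triangle_ineq4)
  have W: "Wfrac \<alpha> ?f n = Wfrac \<alpha> (fourier_coeff g) n - Wfrac \<alpha> (fourier_coeff h) n" for n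
    by (rule Wfrac_diff[OF assms(1) gs hs])
  \<comment> \<open>The weighted sum for the difference must be shown to converge: otherwise
    \<open>A_norm\<close> would be the default 0 and bound nothing.\<close>
  have "(\<lambda>n. ?k n * norm (Wfrac \<alpha> (fourier_coeff g) n) + ?k n * norm (Wfrac \<alpha> (fourier_coeff h) n)) summable_on UNIV"
    using g h by (intro summable_on_add) (auto simp: A_alpha_def)
  then have "(\<lambda>n. ?k n * norm (Wfrac \<alpha> ?f n)) summable_on UNIV"
  proof (rule summable_on_comparison_test)
    show "?k n * norm (Wfrac \<alpha> ?f n) \<le> ?k n * norm (Wfrac \<alpha> (fourier_coeff g) n) + ?k n * norm (Wfrac \<alpha> (fourier_coeff h) n)" for n
      unfolding W distrib_left[symmetric] using assms(1)
      by (intro mult_left_mono norm_triangle_ineq4 kc_nonneg) auto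
  qed (use assms(1) in \<open>auto simp: kc_nonneg\<close>)
  from l1_norm_le_weighted[OF assms(1) f this] show ?thesis
    by (simp add: A_norm_def fc)
qed

section \<open>Operators on a complex Banach space\<close>

lemma blinfun_compose_assoc: "(A o\<^sub>L B) o\<^sub>L C = A o\<^sub>L (B o\<^sub>L C)"
  by (rule blinfun_eqI) simp

lemma blinfun_compose_id [simp]: "A o\<^sub>L id_blinfun = A" "id_blinfun o\<^sub>L A = A"
  by (rule blinfun_eqI; simp)+

lemmas blinfun_compose_linear =
  bounded_bilinear.add_left[OF bounded_bilinear_blinfun_compose]
  bounded_bilinear.add_right[OF bounded_bilinear_blinfun_compose]
  bounded_bilinear.diff_left[OF bounded_bilinear_blinfun_compose]
  bounded_bilinear.diff_right[OF bounded_bilinear_blinfun_compose]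
  bounded_bilinear.minus_left[OF bounded_bilinear_blinfun_compose]
  bounded_bilinear.minus_right[OF bounded_bilinear_blinfun_compose]
  bounded_bilinear.scaleR_left[OF bounded_bilinear_blinfun_compose]
  bounded_bilinear.scaleR_right[OF bounded_bilinear_blinfun_compose]
  bounded_bilinear.sum_left[OF bounded_bilinear_blinfun_compose]
  bounded_bilinear.sum_right[OF bounded_bilinear_blinfun_compose]

lemma opow_Suc: "opow T (Suc j) = opow T j o\<^sub>L T"
proof (induction j)
  case (Suc j)
  have "opow T (Suc (Suc j)) = T o\<^sub>L opow T (Suc j)" by (simp add: opow_def)
  also have "\<dots> = (T o\<^sub>L opow T j) o\<^sub>L T" by (simp add: Suc blinfun_compose_assoc)
  also have "T o\<^sub>L opow T j = opow T (Suc j)" by (simp add: opow_def)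
  finally show ?case .
qed (simp add: opow_def)

lemma opow_0 [simp]: "opow T 0 = id_blinfun"
  by (simp add: opow_def)

lemma cesaro_sum_Suc:
  "cesaro_sum \<alpha> T (Suc n) = (cesaro_sum \<alpha> T n o\<^sub>L T) + kc \<alpha> (Suc n) *\<^sub>R id_blinfun"
  unfolding cesaro_sum_def sum.atMost_Suc_shift
  by (simp add: opow_Suc blinfun_compose_linear)

text \<open>The next mean is a convex combination of M(n) T and the identity, with weight \<alpha> /
  (\<alpha> + n + 1) on the identity. The difference is thus of order 1/n once the means are
  bounded.\<close>

lemma cesaro_mean_shift:
  assumes "0 < \<alpha>"
  shows "(cesaro_mean \<alpha> T n o\<^sub>L T) - cesaro_mean \<alpha> T (Suc n)
    = (\<alpha> / (\<alpha> + n + 1)) *\<^sub>R ((cesaro_mean \<alpha> T n o\<^sub>L T) - id_blinfun)"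
proof -
  define A where "A = (cesaro_mean \<alpha> T n o\<^sub>L T)"
  have pos: "0 < kc (\<alpha> + 1) n" "0 < kc (\<alpha> + 1) (Suc n)" using assms by (auto intro: kc_pos)
  have S: "(cesaro_sum \<alpha> T n o\<^sub>L T) = kc (\<alpha> + 1) n *\<^sub>R A"
    using pos by (simp add: A_def cesaro_mean_def blinfun_compose_linear)
  have ratio: "kc (\<alpha> + 1) n / kc (\<alpha> + 1) (Suc n) = 1 - \<alpha> / (\<alpha> + n + 1)"
    using assms pos by (simp add: kc_Suc divide_simps) (simp add: algebra_simps)
  have "cesaro_mean \<alpha> T (Suc n) = (kc (\<alpha> + 1) n / kc (\<alpha> + 1) (Suc n)) *\<^sub>R A
      + (kc \<alpha> (Suc n) / kc (\<alpha> + 1) (Suc n)) *\<^sub>R id_blinfun"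
    by (simp add: cesaro_mean_def cesaro_sum_Suc S scaleR_right_distrib)
  also have "\<dots> = (1 - \<alpha> / (\<alpha> + n + 1)) *\<^sub>R A + (\<alpha> / (\<alpha> + n + 1)) *\<^sub>R id_blinfun"
    by (simp only: ratio kc_shift[OF assms])
  finally show ?thesis
    unfolding A_def[symmetric] by (simp add: algebra_simps)
qed

section \<open>Complex scalars on operators and resolvent estimates\<close>

locale complex_banach =
  fixes J :: "'a::banach \<Rightarrow>\<^sub>L 'a"
  assumes complex_structure: "complex_structure J"
begin

lemma J_J: "J o\<^sub>L J = - id_blinfun"
  using complex_structure by (simp add: complex_structure_def)

text \<open>In polar form the scalar is a positive factor times a rotation, and
  \<open>complex_structure\<close> makes rotations isometric.\<close>

lemma norm_cscaleL_le: "norm (cscaleL J z A) \<le> norm z * norm A"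
proof (rule norm_blinfun_bound)
  fix x
  have z: "Re z = norm z * cos (Arg z)" "Im z = norm z * sin (Arg z)"
    by (metis Re_rcis rcis_cmod_Arg, metis Im_rcis rcis_cmod_Arg)
  have "cscaleL J z A x = norm z *\<^sub>R (cos (Arg z) *\<^sub>R A x + sin (Arg z) *\<^sub>R J (A x))"
    by (simp add: cscaleL_def blinfun.bilinear_simps scaleR_right_distrib z[symmetric])
  then have "norm (cscaleL J z A x) = norm z * norm (A x)"
    using complex_structure by (simp add: complex_structure_def)
  then show "norm (cscaleL J z A x) \<le> norm z * norm A * norm x"
    using mult_left_mono[OF norm_blinfun[of A x] norm_ge_zero[of z]] by (simp add: mult.assoc)
qed simp

sublocale cs: bounded_bilinear "cscaleL J"
proof
  show "\<exists>K. \<forall>a b. norm (cscaleL J a b) \<le> norm a * norm b * K"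
    by (intro exI[of _ 1]) (use norm_cscaleL_le in simp)
qed (simp_all add: cscaleL_def blinfun_compose_linear algebra_simps)

lemma cscaleL_cscaleL: "cscaleL J z (cscaleL J w A) = cscaleL J (z * w) A"
proof -
  have "J o\<^sub>L (J o\<^sub>L A) = - A"
    by (simp add: blinfun_compose_assoc[symmetric] J_J blinfun_compose_linear)
  then show ?thesis
    by (simp add: cscaleL_def blinfun_compose_linear algebra_simps)
qed

lemma cscaleL_of_real: "cscaleL J (of_real r) A = r *\<^sub>R A"
  by (simp add: cscaleL_def)

lemma cscaleL_1 [simp]: "cscaleL J 1 A = A"
  by (simp add: cscaleL_def)

lemma cscaleL_compose: "cscaleL J z A o\<^sub>L B = cscaleL J z (A o\<^sub>L B)"
  by (simp add: cscaleL_def blinfun_compose_linear blinfun_compose_assoc)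

text \<open>Scalars act by composing with \<open>J\<close> on the left, so they move past a left
  factor only if it commutes with \<open>J\<close>. This is why commutation with \<open>J\<close> is
  tracked for every operator below.\<close>

lemma compose_cscaleL:
  assumes "A o\<^sub>L J = J o\<^sub>L A"
  shows "A o\<^sub>L cscaleL J z B = cscaleL J z (A o\<^sub>L B)"
  by (simp add: cscaleL_def blinfun_compose_linear blinfun_compose_assoc[symmetric] assms)

lemma J_commute_cscaleL:
  assumes "A o\<^sub>L J = J o\<^sub>L A"
  shows "cscaleL J z A o\<^sub>L J = J o\<^sub>L cscaleL J z A"
  using assms by (simp add: cscaleL_compose compose_cscaleL)

text \<open>Perturbing \<open>w0\<close> inside the resolvent set only needs an a priori estimate for
  \<open>q (w - T)\<close>, so no Neumann series is required.\<close>
lemma resolvent_local_bound: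
  assumes "w0 \<notin> op_spectrum J T"
  shows "\<exists>N>0. \<forall>w q. dist w0 w < 1 / N \<longrightarrow> q o\<^sub>L J = J o\<^sub>L q \<longrightarrow>
    norm q \<le> N * norm (cscaleL J w q - (q o\<^sub>L T))"
proof -
  obtain S where S: "(cscaleL J w0 id_blinfun - T) o\<^sub>L S = id_blinfun"
    using assms by (auto simp: op_spectrum_def)
  \<comment> \<open>With this choice the perturbation term is at most half of \<open>norm q\<close>
    and is absorbed on the left; the added 1 keeps \<open>N\<close> positive.\<close>
  define N where "N = 2 * (norm S + 1)"
  have "norm q \<le> N * norm (cscaleL J w q - (q o\<^sub>L T))"
    if w: "dist w0 w < 1 / N" and q: "q o\<^sub>L J = J o\<^sub>L q" for w q
  proof -
    let ?b = "cscaleL J w q - (q o\<^sub>L T)"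
    have "q = (q o\<^sub>L (cscaleL J w0 id_blinfun - T)) o\<^sub>L S"
      by (simp add: blinfun_compose_assoc S)
    also have "q o\<^sub>L (cscaleL J w0 id_blinfun - T) = ?b + cscaleL J (w0 - w) q"
      by (simp add: blinfun_compose_linear compose_cscaleL q cs.diff_left)
    finally have "norm q \<le> norm (?b + cscaleL J (w0 - w) q) * norm S"
      by (metis norm_blinfun_compose)
    also have "\<dots> \<le> (norm ?b + dist w0 w * norm q) * norm S"
      by (intro mult_right_mono order_trans[OF norm_triangle_ineq] add_left_mono)
         (use norm_cscaleL_le in \<open>auto simp: dist_norm\<close>)
    also have "\<dots> = norm ?b * norm S + dist w0 w * norm S * norm q"
      by (simp add: algebra_simps)
    also have "dist w0 w * norm S \<le> 1 / N * norm S"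
      using w by (intro mult_right_mono) auto
    also have "1 / N * norm S \<le> 1 / 2"
      using norm_ge_zero[of S] by (simp add: N_def divide_simps not_less)
    finally have "norm q \<le> norm ?b * norm S + 1 / 2 * norm q"
      by (simp add: mult_right_mono)
    then have "norm q \<le> 2 * norm S * norm ?b" by (simp add: algebra_simps)
    also have "\<dots> \<le> N * norm ?b"
      by (intro mult_right_mono) (auto simp: N_def)
    finally show ?thesis .
  qed
  moreover have "N > 0" by (simp add: N_def add_nonneg_pos)
  ultimately show ?thesis by blast
qed

lemma resolvent_uniform_bound:
  assumes Z: "compact Z" "Z \<inter> op_spectrum J T = {}"
  obtains \<delta> K where "0 < \<delta>" "0 < K"
    "\<And>w0 w q. w0 \<in> Z \<Longrightarrow> dist w0 w < \<delta> \<Longrightarrow> q o\<^sub>L J = J o\<^sub>L q \<Longrightarrow>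
      norm q \<le> K * norm (cscaleL J w q - (q o\<^sub>L T))"
proof -
  have "\<forall>w0\<in>Z. \<exists>N>0. \<forall>w q. dist w0 w < 1 / N \<longrightarrow> q o\<^sub>L J = J o\<^sub>L q \<longrightarrow>
    norm q \<le> N * norm (cscaleL J w q - (q o\<^sub>L T))"
    using Z(2) by (intro ballI resolvent_local_bound) auto
  then obtain N where N: "\<And>w0. w0 \<in> Z \<Longrightarrow> 0 < N w0"
    and est: "\<And>w0 w q. w0 \<in> Z \<Longrightarrow> dist w0 w < 1 / N w0 \<Longrightarrow> q o\<^sub>L J = J o\<^sub>L q \<Longrightarrow>
      norm q \<le> N w0 * norm (cscaleL J w q - (q o\<^sub>L T))"
    by metis
  \<comment> \<open>Balls of half the admissible radius: the other half is left for the distance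
    from a point of \<open>Z\<close> to \<open>w\<close>, which gives one \<delta> for all of
    \<open>Z\<close>.\<close>
  obtain D where D: "D \<subseteq> Z" "finite D" "Z \<subseteq> (\<Union>w0\<in>D. ball w0 (1 / (2 * N w0)))"
  proof (rule compactE_image[OF Z(1), where C = Z and f = "\<lambda>w0. ball w0 (1 / (2 * N w0))"])
    show "Z \<subseteq> (\<Union>w0\<in>Z. ball w0 (1 / (2 * N w0)))" using N by force
  qed auto
  \<comment> \<open>The sum dominates each of the finitely many constants, and the 1 keeps
    \<open>K\<close> positive even for an empty cover.\<close>
  define K where "K = 1 + (\<Sum>w0\<in>D. N w0)"
  have NK: "N w0 \<le> K" if "w0 \<in> D" for w0
  proof -
    have "N w0 \<le> (\<Sum>w0\<in>D. N w0)"
      by (rule member_le_sum) (use that D N in \<open>auto intro: less_imp_le\<close>)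
    then show ?thesis by (simp add: K_def)
  qed
  have K: "0 < K" unfolding K_def using N D by (intro add_pos_nonneg sum_nonneg) (auto intro: less_imp_le)
  show ?thesis
  proof (rule that[of "1 / (2 * K)" K])
    fix w1 w q assume w1: "w1 \<in> Z" and w: "dist w1 w < 1 / (2 * K)" and q: "q o\<^sub>L J = J o\<^sub>L q"
    obtain w0 where w0: "w0 \<in> D" "dist w0 w1 < 1 / (2 * N w0)"
      using D(3) w1 by auto
    have pos: "0 < N w0" using w0 D N by auto
    have "1 / (2 * K) \<le> 1 / (2 * N w0)"
      using NK[OF w0(1)] pos by (intro divide_left_mono) auto
    then have "dist w0 w < 1 / (2 * N w0) + 1 / (2 * N w0)"
      using dist_triangle[of w0 w w1] w w0(2) by linarith
    also have "\<dots> = 1 / N w0" by simp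
    finally have "norm q \<le> N w0 * norm (cscaleL J w q - (q o\<^sub>L T))"
      using est w0 D q by blast
    also have "\<dots> \<le> K * norm (cscaleL J w q - (q o\<^sub>L T))"
      by (intro mult_right_mono NK w0) auto
    finally show "norm q \<le> K * norm (cscaleL J w q - (q o\<^sub>L T))" .
  qed (use K in auto)
qed

end

section \<open>Poisson coefficients\<close>

lemma summable_on_int_geometric:
  fixes r :: real
  assumes "0 \<le> r" "r < 1"
  shows "(\<lambda>j. r ^ nat \<bar>j\<bar>) summable_on (UNIV :: int set)"
proof -
  have geo: "(\<lambda>k. r ^ k) summable_on UNIV"
    using assms by (intro summable_nonneg_imp_summable_on summable_geometric) auto
  have "(\<lambda>j. r ^ nat \<bar>j\<bar>) summable_on {0..}"
    by (rule iffD2[OF summable_on_reindex_bij_witness[where i = int and j = nat] geo]) auto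
  moreover have "(\<lambda>j. r ^ nat \<bar>j\<bar>) summable_on {..-1}"
    by (rule iffD2[OF summable_on_reindex_bij_witness[where i = "\<lambda>n. - 1 - int n" and j = "\<lambda>n. nat (- 1 - n)"]
          summable_on_cmult_right[OF geo, of r]])
       (auto simp: nat_diff_distrib simp flip: power_Suc intro!: arg_cong[where f = "(^) r"])
  ultimately have "(\<lambda>j. r ^ nat \<bar>j\<bar>) summable_on ({0..} \<union> {..-1})"
    by (rule summable_on_union)
  moreover have "{0..} \<union> {..-1} = (UNIV :: int set)" by auto
  ultimately show ?thesis by simp
qed

text \<open>The exponent has the sign of \<open>fourier_coeff\<close>, so integrating
  \<open>h t\<close> against it over a period gives 2 pi r^|j| times the j-th coefficient of
  \<open>h\<close>.\<close>

definition poisson_coeff :: "real \<Rightarrow> real \<Rightarrow> int \<Rightarrow> complex" where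
  "poisson_coeff r t j = of_real (r ^ nat \<bar>j\<bar>) * exp (- \<i> * of_int j * of_real t)"

lemma norm_poisson_coeff: "0 \<le> r \<Longrightarrow> norm (poisson_coeff r t j) = r ^ nat \<bar>j\<bar>"
  by (simp add: poisson_coeff_def norm_mult norm_power)

lemma poisson_coeff_summable:
  "0 \<le> r \<Longrightarrow> r < 1 \<Longrightarrow> (\<lambda>j. norm (poisson_coeff r t j)) summable_on UNIV"
  by (simp add: norm_poisson_coeff summable_on_int_geometric)

text \<open>With z = exp (- i t), the generating function in x is (1 - r^2) / ((1 - r z x)(1 - r /
  (z x))). Multiplying out the denominator leaves the constant 1 - r^2, that is, a single
  coefficient at j = 0.\<close>

lemma poisson_coeff_recurrence:
  "of_real (1 + r\<^sup>2) * poisson_coeff r t j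
    - of_real r * exp (- \<i> * of_real t) * poisson_coeff r t (j - 1)
    - of_real r * exp (\<i> * of_real t) * poisson_coeff r t (j + 1)
    = (if j = 0 then of_real (1 - r\<^sup>2) else 0)"
proof -
  let ?e = "exp (- \<i> * of_int j * of_real t)"
  have e1: "exp (- \<i> * of_real t) * exp (- \<i> * of_int (j - 1) * of_real t) = ?e"
    by (simp add: algebra_simps flip: exp_add)
  have e2: "exp (\<i> * of_real t) * exp (- \<i> * of_int (j + 1) * of_real t) = ?e"
    by (simp add: algebra_simps flip: exp_add)
  have pw: "(1 + r\<^sup>2) * r ^ nat \<bar>j\<bar> - r * r ^ nat \<bar>j - 1\<bar> - r * r ^ nat \<bar>j + 1\<bar> = (if j = 0 then 1 - r\<^sup>2 else 0)"
  proof (cases j rule: int_cases3)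
    case zero
    then show ?thesis by (simp add: power2_eq_square)
  next
    case (pos n)
    then obtain k where "j = int (Suc k)" by (cases n) auto
    moreover have "nat \<bar>int (Suc k) - 1\<bar> = k" "nat \<bar>int (Suc k) + 1\<bar> = Suc (Suc k)" "nat \<bar>int (Suc k)\<bar> = Suc k"
      by auto
    ultimately show ?thesis by (simp only:) (simp add: power2_eq_square algebra_simps)
  next
    case (neg n)
    then obtain k where "j = - int (Suc k)" by (cases n) auto
    moreover have "nat \<bar>- int (Suc k) - 1\<bar> = Suc (Suc k)" "nat \<bar>- int (Suc k) + 1\<bar> = k" "nat \<bar>- int (Suc k)\<bar> = Suc k"
      by auto
    ultimately show ?thesis by (simp only:) (simp add: power2_eq_square algebra_simps)
  qed
  have "of_real (1 + r\<^sup>2) * poisson_coeff r t j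
    - of_real r * exp (- \<i> * of_real t) * poisson_coeff r t (j - 1)
    - of_real r * exp (\<i> * of_real t) * poisson_coeff r t (j + 1)
    = of_real (1 + r\<^sup>2) * of_real (r ^ nat \<bar>j\<bar>) * ?e
      - of_real r * of_real (r ^ nat \<bar>j - 1\<bar>) * (exp (- \<i> * of_real t) * exp (- \<i> * of_int (j - 1) * of_real t))
      - of_real r * of_real (r ^ nat \<bar>j + 1\<bar>) * (exp (\<i> * of_real t) * exp (- \<i> * of_int (j + 1) * of_real t))"
    unfolding poisson_coeff_def by (simp only: mult_ac)
  also have "\<dots> = of_real ((1 + r\<^sup>2) * r ^ nat \<bar>j\<bar> - r * r ^ nat \<bar>j - 1\<bar> - r * r ^ nat \<bar>j + 1\<bar>) * ?e"
    unfolding e1 e2 by (simp add: algebra_simps)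
  also have "\<dots> = (if j = 0 then of_real (1 - r\<^sup>2) else 0)"
    unfolding pw by simp
  finally show ?thesis .
qed

section \<open>Cesaro means under the shift\<close>

locale cesaro_bounded_op = complex_banach J for J :: "'a::banach \<Rightarrow>\<^sub>L 'a" +
  fixes T :: "'a \<Rightarrow>\<^sub>L 'a" and \<alpha> C :: real
  assumes T_linear: "complex_linear_op J T"
    and alpha_pos: "0 < \<alpha>"
    and mean_le: "\<And>n. norm (cesaro_mean \<alpha> T n) \<le> C"
begin

lemma C_nonneg: "0 \<le> C"
  using mean_le[of 0] norm_ge_zero order_trans by blast

lemma opow_J: "opow T j o\<^sub>L J = J o\<^sub>L opow T j"
proof (induction j)
  case (Suc j)
  have "opow T (Suc j) o\<^sub>L J = opow T j o\<^sub>L (J o\<^sub>L T)"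
    using T_linear by (simp add: opow_Suc blinfun_compose_assoc complex_linear_op_def)
  also have "\<dots> = J o\<^sub>L opow T (Suc j)"
    by (simp add: Suc opow_Suc blinfun_compose_assoc[symmetric])
  finally show ?case .
qed simp

lemma mean_J: "cesaro_mean \<alpha> T n o\<^sub>L J = J o\<^sub>L cesaro_mean \<alpha> T n"
  by (simp add: cesaro_mean_def cesaro_sum_def blinfun_compose_linear opow_J)

lemma norm_cesaro_sum_le: "norm (cesaro_sum \<alpha> T n) \<le> C * kc (\<alpha> + 1) n"
proof -
  have "0 < kc (\<alpha> + 1) n" using alpha_pos by (intro kc_pos) simp
  then show ?thesis
    using mean_le[of n] by (simp add: cesaro_mean_def field_simps)
qed

lemma mean_shift_tendsto: "(\<lambda>n. (cesaro_mean \<alpha> T n o\<^sub>L T) - cesaro_mean \<alpha> T (Suc n)) \<longlonglongrightarrow> 0"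
proof (rule Lim_null_comparison)
  have "norm ((cesaro_mean \<alpha> T n o\<^sub>L T) - id_blinfun) \<le> C * norm T + 1" for n
    using norm_blinfun_compose[of "cesaro_mean \<alpha> T n" T] mult_right_mono[OF mean_le[of n] norm_ge_zero[of T]]
      norm_triangle_ineq4[of "(cesaro_mean \<alpha> T n o\<^sub>L T)" id_blinfun] norm_blinfun_id_le[where 'a = 'a]
    by linarith
  then show "\<forall>\<^sub>F n in sequentially. norm ((cesaro_mean \<alpha> T n o\<^sub>L T) - cesaro_mean \<alpha> T (Suc n))
      \<le> \<alpha> / (\<alpha> + n + 1) * (C * norm T + 1)"
    using alpha_pos by (intro always_eventually allI) (simp add: cesaro_mean_shift mult_left_mono divide_right_mono)
  show "(\<lambda>n. \<alpha> / (\<alpha> + n + 1) * (C * norm T + 1)) \<longlonglongrightarrow> 0"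
  proof (rule tendsto_mult_left_zero, rule tendsto_divide_0[OF tendsto_const], rule filterlim_at_top_imp_at_infinity)
    show "filterlim (\<lambda>n. \<alpha> + real n + 1) at_top sequentially"
      using filterlim_tendsto_add_at_top[OF tendsto_const[of "\<alpha> + 1"] filterlim_real_sequentially]
      by (simp add: algebra_simps)
  qed
qed

lemma mean_opow_tendsto: "(\<lambda>n. (cesaro_mean \<alpha> T n o\<^sub>L opow T j) - cesaro_mean \<alpha> T (n + j)) \<longlonglongrightarrow> 0"
proof (induction j)
  case (Suc j)
  have "(\<lambda>n. (((cesaro_mean \<alpha> T n o\<^sub>L opow T j) - cesaro_mean \<alpha> T (n + j)) o\<^sub>L T)
      + ((cesaro_mean \<alpha> T (n + j) o\<^sub>L T) - cesaro_mean \<alpha> T (Suc (n + j)))) \<longlonglongrightarrow> (0 o\<^sub>L T) + 0"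
    by (intro tendsto_add bounded_bilinear.tendsto[OF bounded_bilinear_blinfun_compose] Suc tendsto_const
        LIMSEQ_ignore_initial_segment[OF mean_shift_tendsto])
  then show ?case
    by (simp add: opow_Suc blinfun_compose_linear blinfun_compose_assoc)
qed simp

text \<open>Extension by zero makes every integer translate available, so two-sided convolutions are
  defined. It keeps the bound \<open>C\<close>, and the false jump it creates at -1 is invisible as
  the index tends to plus infinity.\<close>

definition meanz :: "int \<Rightarrow> 'a \<Rightarrow>\<^sub>L 'a" where
  "meanz k = (if k \<ge> 0 then cesaro_mean \<alpha> T (nat k) else 0)"

lemma norm_meanz_le: "norm (meanz k) \<le> C"
  using mean_le C_nonneg by (simp add: meanz_def)

lemma meanz_J: "meanz k o\<^sub>L J = J o\<^sub>L meanz k"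
  by (simp add: meanz_def mean_J)

lemma meanz_shift_tendsto: "((\<lambda>k. (meanz k o\<^sub>L T) - meanz (k + 1)) \<longlongrightarrow> 0) at_top"
proof (rule Lim_transform_eventually)
  show "((\<lambda>k. (cesaro_mean \<alpha> T (nat k) o\<^sub>L T) - cesaro_mean \<alpha> T (Suc (nat k))) \<longlongrightarrow> 0) at_top"
    by (rule filterlim_compose[OF mean_shift_tendsto filterlim_nat_sequentially])
  show "\<forall>\<^sub>F k in at_top. (cesaro_mean \<alpha> T (nat k) o\<^sub>L T) - cesaro_mean \<alpha> T (Suc (nat k))
      = (meanz k o\<^sub>L T) - meanz (k + 1)"
    using eventually_ge_at_top[of 0] by eventually_elim (simp add: meanz_def nat_add_distrib)
qed

lemma norm_meanz_shift_le: "norm ((meanz k o\<^sub>L T) - meanz (k + 1)) \<le> C * norm T + C"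
  using norm_blinfun_compose[of "meanz k" T] mult_right_mono[OF norm_meanz_le[of k] norm_ge_zero[of T]]
    norm_triangle_ineq4[of "(meanz k o\<^sub>L T)" "meanz (k + 1)"] norm_meanz_le[of "k + 1"]
  by linarith

text \<open>The series with coefficients \<open>f\<close> in the shift, applied to the means and
  evaluated at \<open>n\<close>.\<close>

definition meanz_conv :: "(int \<Rightarrow> complex) \<Rightarrow> int \<Rightarrow> 'a \<Rightarrow>\<^sub>L 'a" where
  "meanz_conv f n = (\<Sum>\<^sub>\<infinity>j. cscaleL J (f j) (meanz (n + j)))"

lemma meanz_conv_abs_summable:
  assumes "(\<lambda>j. norm (f j)) summable_on UNIV"
  shows "(\<lambda>j. norm (cscaleL J (f j) (meanz (n + j)))) summable_on UNIV"
proof (rule summable_on_comparison_test[OF summable_on_cmult_left[OF assms, of C]])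
  show "norm (cscaleL J (f j) (meanz (n + j))) \<le> norm (f j) * C" for j
    by (rule order_trans[OF norm_cscaleL_le]) (intro mult_left_mono norm_meanz_le, simp)
qed auto

lemma meanz_conv_has_sum:
  assumes "(\<lambda>j. norm (f j)) summable_on UNIV"
  shows "((\<lambda>j. cscaleL J (f j) (meanz (n + j))) has_sum meanz_conv f n) UNIV"
  unfolding meanz_conv_def
  by (rule has_sum_infsum[OF abs_summable_summable[OF meanz_conv_abs_summable[OF assms]]])

lemma norm_meanz_conv_le:
  assumes "(\<lambda>j. norm (f j)) summable_on UNIV"
  shows "norm (meanz_conv f n) \<le> C * (\<Sum>\<^sub>\<infinity>j. norm (f j))"
proof (rule norm_infsum_le[OF meanz_conv_has_sum[OF assms] has_sum_cmult_right[OF has_sum_infsum[OF assms]]])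
  show "norm (cscaleL J (f j) (meanz (n + j))) \<le> C * norm (f j)" for j
    by (subst mult.commute, rule order_trans[OF norm_cscaleL_le]) (intro mult_left_mono norm_meanz_le, simp)
qed

lemma meanz_conv_diff:
  assumes f: "(\<lambda>j. norm (f j)) summable_on UNIV" and g: "(\<lambda>j. norm (g j)) summable_on UNIV"
  shows "meanz_conv (\<lambda>j. f j - g j) n = meanz_conv f n - meanz_conv g n"
proof -
  have "((\<lambda>j. cscaleL J (f j) (meanz (n + j)) + - cscaleL J (g j) (meanz (n + j)))
      has_sum meanz_conv f n + - meanz_conv g n) UNIV"
    by (intro has_sum_add) (use meanz_conv_has_sum[OF f] meanz_conv_has_sum[OF g] in \<open>auto simp: has_sum_uminus\<close>)
  then have "((\<lambda>j. cscaleL J (f j - g j) (meanz (n + j))) has_sum meanz_conv f n - meanz_conv g n) UNIV"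
    by (simp add: cs.diff_left)
  then show ?thesis
    unfolding meanz_conv_def by (rule infsumI)
qed

section \<open>Comparison of theta with convolution against the means\<close>

lemma theta_has_sum:
  assumes w: "(\<lambda>k. kc (\<alpha> + 1) k * norm (Wp \<alpha> f (int k))) summable_on UNIV"
  shows "((\<lambda>k. cscaleL J (Wp \<alpha> f (int k)) (cesaro_sum \<alpha> T k)) has_sum theta J \<alpha> T f) UNIV"
proof -
  have "(\<lambda>k. norm (cscaleL J (Wp \<alpha> f (int k)) (cesaro_sum \<alpha> T k))) summable_on UNIV"
  proof (rule summable_on_comparison_test[OF summable_on_cmult_right[OF w, of C]])
    fix k
    have "norm (cscaleL J (Wp \<alpha> f (int k)) (cesaro_sum \<alpha> T k)) \<le> norm (Wp \<alpha> f (int k)) * (C * kc (\<alpha> + 1) k)"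
      by (rule order_trans[OF norm_cscaleL_le]) (intro mult_left_mono norm_cesaro_sum_le, simp)
    then show "norm (cscaleL J (Wp \<alpha> f (int k)) (cesaro_sum \<alpha> T k)) \<le> C * (kc (\<alpha> + 1) k * norm (Wp \<alpha> f (int k)))"
      by (simp add: mult_ac)
  qed auto
  then have "((\<lambda>k. cscaleL J (Wp \<alpha> f (int k)) (cesaro_sum \<alpha> T k)) has_sum
      (\<Sum>\<^sub>\<infinity>k. cscaleL J (Wp \<alpha> f (int k)) (cesaro_sum \<alpha> T k))) UNIV"
    by (rule has_sum_infsum[OF abs_summable_summable])
  from this sums_unique[OF has_sum_imp_sums[OF this]] show ?thesis
    unfolding theta_def by (simp only:)
qed

text \<open>Inserting f(j) as the Weyl sum of \<open>Wp \<alpha> f\<close> and exchanging sums gives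
  the series of \<open>theta\<close> with each power T^j replaced by M(n + j), so the two can be
  compared term by term.\<close>

lemma meanz_conv_has_sum_weyl:
  assumes f: "(\<lambda>j. norm (f j)) summable_on UNIV" and f0: "\<And>n. n < 0 \<Longrightarrow> f n = 0"
    and w: "(\<lambda>k. kc (\<alpha> + 1) k * norm (Wp \<alpha> f (int k))) summable_on UNIV"
  shows "((\<lambda>k. cscaleL J (Wp \<alpha> f (int k)) (\<Sum>j\<le>k. kc \<alpha> (k - j) *\<^sub>R cesaro_mean \<alpha> T (n + j)))
      has_sum meanz_conv f (int n)) UNIV"
proof -
  define M where "M = cesaro_mean \<alpha> T"
  define W where "W k = Wp \<alpha> f (int k)" for k
  define F where "F = (\<lambda>i j. cscaleL J (of_real (kc \<alpha> i) * W (j + i)) (M (n + j)))"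
  have w': "(\<lambda>k. kc (\<alpha> + 1) k * norm (W k)) summable_on UNIV" using w by (simp add: W_def)
  have "W = weyl_diff \<alpha> (\<lambda>k. f (int k))"
    unfolding W_def by (rule ext, rule Wp_nat)
  then have inv: "weyl_sum \<alpha> W j = f (int j)" for j
    using weyl_sum_weyl_diff[OF alpha_pos summable_on_int_nonneg[OF f]] w' by simp
  have norm_F: "norm (F i j) \<le> kc \<alpha> i * norm (W (j + i)) * C" for i j
  proof -
    have "norm (F i j) \<le> norm (of_real (kc \<alpha> i) * W (j + i)) * C"
      unfolding F_def M_def by (rule order_trans[OF norm_cscaleL_le]) (intro mult_left_mono mean_le, simp)
    then show ?thesis using alpha_pos by (simp add: norm_mult kc_nonneg)
  qed
  have sum_F: "(\<Sum>j\<le>k. F (k - j) j) = cscaleL J (W k) (\<Sum>j\<le>k. kc \<alpha> (k - j) *\<^sub>R M (n + j))" for k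
    by (simp add: F_def cs.sum_right cs.scaleR_right cs.scaleR_left scaleR_conv_of_real[symmetric] cong: sum.cong_simp)
  have F_summ: "(\<lambda>k. \<Sum>j\<le>k. norm (F (k - j) j)) summable_on UNIV"
  proof (rule summable_on_comparison_test[OF summable_on_cmult_right[OF w', of C]])
    fix k
    have "(\<Sum>j\<le>k. norm (F (k - j) j)) \<le> (\<Sum>j\<le>k. kc \<alpha> (k - j) * norm (W k) * C)"
      by (rule sum_mono) (metis norm_F atMost_iff le_add_diff_inverse)
    also have "\<dots> = C * (kc (\<alpha> + 1) k * norm (W k))"
      by (simp add: sum_kc[symmetric] sum_distrib_left sum_distrib_right mult_ac)
    finally show "(\<Sum>j\<le>k. norm (F (k - j) j)) \<le> C * (kc (\<alpha> + 1) k * norm (W k))" .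
  qed (simp add: sum_nonneg)
  have row: "(\<Sum>\<^sub>\<infinity>i. F i j) = cscaleL J (f (int j)) (M (n + j))" for j
  proof -
    have "(\<lambda>i. norm (of_real (kc \<alpha> i) * W (j + i))) summable_on UNIV"
      by (rule summable_on_comparison_test[OF kc_weighted_summable_shift[OF _ w', of j]])
         (use alpha_pos in \<open>auto simp: norm_mult kc_nonneg intro!: mult_right_mono kc_mono_left\<close>)
    then have "((\<lambda>i. of_real (kc \<alpha> i) * W (j + i)) has_sum f (int j)) UNIV"
      unfolding inv[symmetric] weyl_sum_def by (rule has_sum_infsum[OF abs_summable_summable])
    from has_sum_bounded_linear[OF cs.bounded_linear_left this]
    show ?thesis unfolding F_def by (rule infsumI)
  qed
  have "(\<lambda>k. norm (\<Sum>j\<le>k. F (k - j) j)) summable_on UNIV"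
    by (rule summable_on_comparison_test[OF F_summ]) (auto intro: norm_sum)
  then have "((\<lambda>k. \<Sum>j\<le>k. F (k - j) j) has_sum (\<Sum>\<^sub>\<infinity>j. \<Sum>\<^sub>\<infinity>i. F i j)) UNIV"
    unfolding infsum_triangle[OF F_summ, symmetric] by (rule has_sum_infsum[OF abs_summable_summable])
  moreover have "(\<Sum>\<^sub>\<infinity>j. \<Sum>\<^sub>\<infinity>i. F i j) = meanz_conv f (int n)"
  proof -
    have "meanz_conv f (int n) = (\<Sum>\<^sub>\<infinity>j. cscaleL J (f (int j)) (meanz (int n + int j)))
        + (\<Sum>\<^sub>\<infinity>j. cscaleL J (f (- 1 - int j)) (meanz (int n + (- 1 - int j))))"
      unfolding meanz_conv_def
      by (rule infsum_int_split[OF abs_summable_summable[OF meanz_conv_abs_summable[OF f]]])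
    also have "(\<Sum>\<^sub>\<infinity>j. cscaleL J (f (- 1 - int j)) (meanz (int n + (- 1 - int j)))) = 0"
      by (rule infsum_0) (simp add: f0 cs.zero_left)
    finally show ?thesis
      by (simp add: row meanz_def M_def nat_add_distrib)
  qed
  ultimately show ?thesis
    by (simp only: sum_F W_def M_def)
qed

text \<open>For fixed \<open>k\<close> the discrepancy \<open>R n k\<close> involves only finitely
  many differences M(n) T^j - M(n + j), each tending to 0; dominated convergence handles the sum
  over \<open>k\<close>.\<close>

lemma mean_theta_tendsto:
  assumes f: "(\<lambda>j. norm (f j)) summable_on UNIV" and f0: "\<And>n. n < 0 \<Longrightarrow> f n = 0"
    and w: "(\<lambda>k. kc (\<alpha> + 1) k * norm (Wp \<alpha> f (int k))) summable_on UNIV"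
  shows "(\<lambda>n. (cesaro_mean \<alpha> T n o\<^sub>L theta J \<alpha> T f) - meanz_conv f (int n)) \<longlonglongrightarrow> 0"
proof -
  define M where "M = cesaro_mean \<alpha> T"
  define W where "W k = Wp \<alpha> f (int k)" for k
  define R where "R n k = (M n o\<^sub>L cesaro_sum \<alpha> T k) - (\<Sum>j\<le>k. kc \<alpha> (k - j) *\<^sub>R M (n + j))" for n k
  have R: "R n k = (\<Sum>j\<le>k. kc \<alpha> (k - j) *\<^sub>R ((M n o\<^sub>L opow T j) - M (n + j)))" for n k
    by (simp add: R_def cesaro_sum_def blinfun_compose_linear sum_subtractf scaleR_right_diff_distrib)
  have R_lim: "(\<lambda>n. R n k) \<longlonglongrightarrow> 0" for k
  proof -
    have "(\<lambda>n. R n k) \<longlonglongrightarrow> (\<Sum>j\<le>k. kc \<alpha> (k - j) *\<^sub>R 0)"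
      unfolding R M_def by (intro tendsto_sum tendsto_scaleR tendsto_const mean_opow_tendsto)
    then show ?thesis by simp
  qed
  \<comment> \<open>The majorant must be uniform in \<open>n\<close> and grow no faster than the
    weight. The Cesaro sum is therefore estimated as a whole, since its individual powers may be too
    large.\<close>
  have R_bound: "norm (R n k) \<le> (C * C + C) * kc (\<alpha> + 1) k" for n k
  proof -
    have "norm (M n o\<^sub>L cesaro_sum \<alpha> T k) \<le> C * (C * kc (\<alpha> + 1) k)"
      unfolding M_def
      by (rule order_trans[OF norm_blinfun_compose]) (intro mult_mono mean_le norm_cesaro_sum_le C_nonneg norm_ge_zero)
    moreover have "norm (\<Sum>j\<le>k. kc \<alpha> (k - j) *\<^sub>R M (n + j)) \<le> (\<Sum>j\<le>k. kc \<alpha> (k - j) * C)"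
      by (rule sum_norm_le) (use alpha_pos mean_le in \<open>simp add: M_def kc_nonneg mult_left_mono\<close>)
    moreover have "(\<Sum>j\<le>k. kc \<alpha> (k - j) * C) = C * kc (\<alpha> + 1) k"
      by (simp add: sum_kc[symmetric] sum_distrib_left mult_ac)
    ultimately show ?thesis
      unfolding R_def using norm_triangle_ineq4[of "M n o\<^sub>L cesaro_sum \<alpha> T k" "\<Sum>j\<le>k. kc \<alpha> (k - j) *\<^sub>R M (n + j)"]
      by (simp add: algebra_simps)
  qed
  have "((\<lambda>k. cscaleL J (W k) (R n k)) has_sum (M n o\<^sub>L theta J \<alpha> T f) - meanz_conv f (int n)) UNIV" for n
  proof -
    have "((\<lambda>k. M n o\<^sub>L cscaleL J (W k) (cesaro_sum \<alpha> T k)) has_sum (M n o\<^sub>L theta J \<alpha> T f)) UNIV"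
      unfolding W_def
      by (rule has_sum_bounded_linear[OF bounded_bilinear.bounded_linear_right[OF bounded_bilinear_blinfun_compose] theta_has_sum[OF w]])
    then have "((\<lambda>k. cscaleL J (W k) (M n o\<^sub>L cesaro_sum \<alpha> T k)
        + - cscaleL J (W k) (\<Sum>j\<le>k. kc \<alpha> (k - j) *\<^sub>R M (n + j)))
        has_sum (M n o\<^sub>L theta J \<alpha> T f) + - meanz_conv f (int n)) UNIV"
      using meanz_conv_has_sum_weyl[OF f f0 w, of n]
      by (intro has_sum_add) (auto simp: has_sum_uminus compose_cscaleL mean_J M_def W_def)
    then show ?thesis
      by (simp add: R_def cs.diff_right)
  qed
  then have eq: "(M n o\<^sub>L theta J \<alpha> T f) - meanz_conv f (int n) = (\<Sum>\<^sub>\<infinity>k. cscaleL J (W k) (R n k))" for n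
    by (rule infsumI[symmetric])
  have "(\<lambda>n. \<Sum>\<^sub>\<infinity>k. cscaleL J (W k) (R n k)) \<longlonglongrightarrow> (\<Sum>\<^sub>\<infinity>k::nat. 0)"
  proof (rule tendsto_infsum_dominated)
    show "(\<lambda>n. cscaleL J (W k) (R n k)) \<longlonglongrightarrow> 0" for k
      using cs.tendsto[OF tendsto_const R_lim, of "W k" k] by (simp add: cs.zero_right)
    show "norm (cscaleL J (W k) (R n k)) \<le> (C * C + C) * (kc (\<alpha> + 1) k * norm (W k))" for n k
      using order_trans[OF norm_cscaleL_le mult_left_mono[OF R_bound norm_ge_zero[of "W k"]]]
      by (simp add: mult_ac)
    show "(\<lambda>k. (C * C + C) * (kc (\<alpha> + 1) k * norm (W k))) summable_on UNIV"
      using w by (intro summable_on_cmult_right) (simp add: W_def)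
  qed simp
  then show ?thesis
    unfolding eq[symmetric] M_def by simp
qed

section \<open>Poisson means of the Cesaro means\<close>

lemma meanz_conv_J:
  assumes "(\<lambda>j. norm (f j)) summable_on UNIV"
  shows "meanz_conv f n o\<^sub>L J = J o\<^sub>L meanz_conv f n"
proof (rule has_sum_unique)
  show "((\<lambda>j. cscaleL J (f j) (meanz (n + j)) o\<^sub>L J) has_sum (meanz_conv f n o\<^sub>L J)) UNIV"
    by (rule has_sum_bounded_linear[OF bounded_bilinear.bounded_linear_left[OF bounded_bilinear_blinfun_compose]
          meanz_conv_has_sum[OF assms]])
  show "((\<lambda>j. cscaleL J (f j) (meanz (n + j)) o\<^sub>L J) has_sum (J o\<^sub>L meanz_conv f n)) UNIV"
    using has_sum_bounded_linear[OF bounded_bilinear.bounded_linear_right[OF bounded_bilinear_blinfun_compose]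
        meanz_conv_has_sum[OF assms, of n], of J]
    by (simp add: J_commute_cscaleL meanz_J)
qed

lemma meanz_conv_translate: "meanz_conv f (n + m) = meanz_conv (\<lambda>j. f (j - m)) n"
  unfolding meanz_conv_def
  by (rule infsum_reindex_bij_witness[where i = "\<lambda>j. j - m" and j = "\<lambda>j. j + m"]) (auto simp: algebra_simps)

lemma meanz_conv_cmult:
  assumes "(\<lambda>j. norm (f j)) summable_on UNIV"
  shows "meanz_conv (\<lambda>j. a * f j) n = cscaleL J a (meanz_conv f n)"
  using infsumI[OF has_sum_bounded_linear[OF cs.bounded_linear_right meanz_conv_has_sum[OF assms], of a n]]
  by (simp add: meanz_conv_def cscaleL_cscaleL)

lemma meanz_conv_delta: "meanz_conv (\<lambda>j. if j = 0 then c else 0) n = cscaleL J c (meanz n)"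
proof -
  have "meanz_conv (\<lambda>j. if j = 0 then c else 0) n = (\<Sum>\<^sub>\<infinity>j\<in>{0}. cscaleL J c (meanz (n + j)))"
    unfolding meanz_conv_def by (rule infsum_cong_neutral) (auto simp: cs.zero_left)
  then show ?thesis by simp
qed

text \<open>The defect of \<open>T\<close> from being the shift. Its convolutions with absolutely
  summable weights still tend to 0, which replaces working modulo null sequences.\<close>

definition shift_err :: "int \<Rightarrow> real" where
  "shift_err k = norm ((meanz k o\<^sub>L T) - meanz (k + 1))"

lemma shift_err_summable:
  assumes "(\<lambda>j. norm (f j)) summable_on UNIV"
  shows "(\<lambda>j. norm (f j) * shift_err (n + j)) summable_on UNIV"
  by (rule summable_on_comparison_test[OF summable_on_cmult_left[OF assms, of "C * norm T + C"]])
     (auto simp: shift_err_def norm_meanz_shift_le mult_left_mono)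

lemma norm_meanz_conv_shift_le:
  assumes f: "(\<lambda>j. norm (f j)) summable_on UNIV"
  shows "norm ((meanz_conv f n o\<^sub>L T) - meanz_conv f (n + 1)) \<le> (\<Sum>\<^sub>\<infinity>j. norm (f j) * shift_err (n + j))"
proof (rule norm_infsum_le[OF _ has_sum_infsum[OF shift_err_summable[OF f]]])
  have "((\<lambda>j. (cscaleL J (f j) (meanz (n + j)) o\<^sub>L T) + - cscaleL J (f j) (meanz (n + 1 + j)))
      has_sum (meanz_conv f n o\<^sub>L T) + - meanz_conv f (n + 1)) UNIV"
    using has_sum_bounded_linear[OF bounded_bilinear.bounded_linear_left[OF bounded_bilinear_blinfun_compose]
        meanz_conv_has_sum[OF f, of n], of T] meanz_conv_has_sum[OF f, of "n + 1"]
    by (intro has_sum_add) (auto simp: has_sum_uminus)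
  then show "((\<lambda>j. cscaleL J (f j) ((meanz (n + j) o\<^sub>L T) - meanz (n + j + 1)))
      has_sum (meanz_conv f n o\<^sub>L T) - meanz_conv f (n + 1)) UNIV"
    by (simp add: cs.diff_right cscaleL_compose add_ac)
  show "norm (cscaleL J (f j) ((meanz (n + j) o\<^sub>L T) - meanz (n + j + 1))) \<le> norm (f j) * shift_err (n + j)" for j
    unfolding shift_err_def by (rule norm_cscaleL_le)
qed

lemma shift_err_conv_tendsto:
  assumes f: "(\<lambda>j. norm (f j)) summable_on UNIV"
  shows "((\<lambda>n. \<Sum>\<^sub>\<infinity>j. norm (f j) * shift_err (n + j)) \<longlongrightarrow> 0) at_top"
proof -
  have "((\<lambda>n. \<Sum>\<^sub>\<infinity>j. norm (f j) * shift_err (n + j)) \<longlongrightarrow> (\<Sum>\<^sub>\<infinity>j::int. 0)) at_top"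
  proof (rule tendsto_infsum_dominated)
    fix j :: int
    have "filterlim (\<lambda>n. n + j) at_top at_top"
      unfolding filterlim_at_top
    proof
      fix Z :: int
      show "\<forall>\<^sub>F n in at_top. Z \<le> n + j"
        using eventually_ge_at_top[of "Z - j"] by eventually_elim simp
    qed
    then have "((\<lambda>n. shift_err (n + j)) \<longlongrightarrow> 0) at_top"
      unfolding shift_err_def
      by (rule filterlim_compose[OF tendsto_norm_zero[OF meanz_shift_tendsto]])
    then show "((\<lambda>n. norm (f j) * shift_err (n + j)) \<longlongrightarrow> 0) at_top"
      by (rule tendsto_mult_right_zero)
  next
    show "norm (norm (f j) * shift_err (n + j)) \<le> norm (f j) * (C * norm T + C)" for n j
      by (simp add: shift_err_def norm_meanz_shift_le mult_left_mono)
    show "(\<lambda>j. norm (f j) * (C * norm T + C)) summable_on UNIV"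
      by (rule summable_on_cmult_left[OF f])
  qed simp
  then show ?thesis by simp
qed

lemma poisson_recurrence:
  fixes r t :: real
  assumes "0 \<le> r" "r < 1"
  defines "q \<equiv> \<lambda>n. meanz_conv (poisson_coeff r t) n"
  shows "(1 + r\<^sup>2) *\<^sub>R q n - cscaleL J (of_real r * exp (- \<i> * of_real t)) (q (n + 1))
    - cscaleL J (of_real r * exp (\<i> * of_real t)) (q (n - 1)) = (1 - r\<^sup>2) *\<^sub>R meanz n"
proof -
  let ?c = "poisson_coeff r t"
  let ?a = "of_real r * exp (- \<i> * of_real t) :: complex" and ?b = "of_real r * exp (\<i> * of_real t) :: complex"
  note c = poisson_coeff_summable[OF assms(1,2), of t]
  have sh: "(\<lambda>j. norm (?c (j - m))) summable_on UNIV" for m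
    by (rule iffD1[OF summable_on_reindex_bij_witness[where i = "\<lambda>j. j - m" and j = "\<lambda>j. j + m"] c]) auto
  have cm: "(\<lambda>j. norm (a * f j)) summable_on UNIV" if "(\<lambda>j. norm (f j)) summable_on UNIV"
    for a :: complex and f :: "int \<Rightarrow> complex"
    unfolding norm_mult by (rule summable_on_cmult_right[OF that])
  have df: "(\<lambda>j. norm (f j - g j)) summable_on UNIV"
    if "(\<lambda>j. norm (f j)) summable_on UNIV" "(\<lambda>j. norm (g j)) summable_on UNIV" for f g :: "int \<Rightarrow> complex"
    by (rule summable_on_comparison_test[OF summable_on_add[OF that]]) (auto intro: norm_triangle_ineq4)
  have "(1 + r\<^sup>2) *\<^sub>R q n - cscaleL J ?a (q (n + 1)) - cscaleL J ?b (q (n - 1))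
    = meanz_conv (\<lambda>j. of_real (1 + r\<^sup>2) * ?c j - ?a * ?c (j - 1) - ?b * ?c (j - - 1)) n"
    unfolding meanz_conv_diff[OF df[OF cm[OF c] cm[OF sh]] cm[OF sh]] meanz_conv_diff[OF cm[OF c] cm[OF sh]]
      meanz_conv_cmult[OF c] meanz_conv_cmult[OF sh]
    unfolding meanz_conv_translate[symmetric] cscaleL_of_real q_def by simp
  also have "\<dots> = meanz_conv (\<lambda>j. if j = 0 then of_real (1 - r\<^sup>2) else 0) n"
    using poisson_coeff_recurrence[of r t] by simp
  also have "\<dots> = (1 - r\<^sup>2) *\<^sub>R meanz n"
    by (simp only: meanz_conv_delta cscaleL_of_real)
  finally show ?thesis .
qed

text \<open>With \<open>z = exp (- i t)\<close> and up to \<open>shift_err\<close>, multiplication by \<open>T\<close> acts on the Poisson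
  means \<open>q\<close> as the shift, so the recurrence factors as \<open>q (1 - r z T) (T - r / z) = (1 - r\<^sup>2) M T\<close>.\<close>
lemma poisson_bound:
  assumes r: "0 < r" "r < 1" and K: "0 < K"
    and inner: "\<And>q. q o\<^sub>L J = J o\<^sub>L q \<Longrightarrow>
      norm q \<le> K * norm (cscaleL J (of_real r * exp (\<i> * of_real t)) q - (q o\<^sub>L T))"
    and outer: "\<And>q. q o\<^sub>L J = J o\<^sub>L q \<Longrightarrow>
      norm q \<le> K * norm (cscaleL J (of_real (1 / r) * exp (\<i> * of_real t)) q - (q o\<^sub>L T))"
  defines "\<eta> \<equiv> \<lambda>n. \<Sum>\<^sub>\<infinity>j. r ^ nat \<bar>j\<bar> * shift_err (n + j)"
  shows "norm (meanz_conv (poisson_coeff r t) n)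
    \<le> K * K / r * ((1 - r\<^sup>2) * C * norm T + \<eta> n * norm T + \<eta> (n - 1))"
proof -
  have r': "0 \<le> r" using r by simp
  define a where "a = of_real r * exp (- \<i> * of_real t)"
  define b where "b = of_real r * exp (\<i> * of_real t)"
  have na: "norm a = r" and nb: "norm b = r" using r by (auto simp: a_def b_def norm_mult)
  have "b * a = of_real (r\<^sup>2)"
    by (simp add: a_def b_def power2_eq_square mult_ac flip: exp_add)
  then have ba: "cscaleL J (b * a) A = r\<^sup>2 *\<^sub>R A" for A
    by (simp only: cscaleL_of_real)
  note c = poisson_coeff_summable[OF r' r(2), of t]
  define q where "q n = meanz_conv (poisson_coeff r t) n" for n
  define E where "E n = (q n o\<^sub>L T) - q (n + 1)" for n
  have E: "norm (E n) \<le> \<eta> n" for n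
    using norm_meanz_conv_shift_le[OF c, of n] by (simp add: E_def q_def \<eta>_def norm_poisson_coeff r')
  have qJ: "q n o\<^sub>L J = J o\<^sub>L q n" for n
    unfolding q_def by (rule meanz_conv_J[OF c])
  \<comment> \<open>Composing with \<open>T\<close> replaces the backward neighbour by q(n - 1) T,
    which is q(n) up to the error E(n - 1); no inverse of the shift is needed.\<close>
  have rec: "(1 + r\<^sup>2) *\<^sub>R (q n o\<^sub>L T) - cscaleL J a (q (n + 1) o\<^sub>L T) - cscaleL J b (q (n - 1) o\<^sub>L T)
      = (1 - r\<^sup>2) *\<^sub>R (meanz n o\<^sub>L T)"
    using arg_cong[OF poisson_recurrence[OF r' r(2), of t n], of "\<lambda>A. A o\<^sub>L T"]
    by (simp add: q_def a_def b_def blinfun_compose_linear cscaleL_compose)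
  define p where "p = q n - cscaleL J a (q n o\<^sub>L T)"
  have pJ: "p o\<^sub>L J = J o\<^sub>L p"
  proof -
    have "(q n o\<^sub>L T) o\<^sub>L J = J o\<^sub>L (q n o\<^sub>L T)"
      using T_linear qJ[of n] by (metis blinfun_compose_assoc complex_linear_op_def)
    then show ?thesis
      by (simp add: p_def blinfun_compose_linear qJ J_commute_cscaleL)
  qed
  have "cscaleL J b p - (p o\<^sub>L T) = cscaleL J a (E n o\<^sub>L T) - cscaleL J b (E (n - 1)) - (1 - r\<^sup>2) *\<^sub>R (meanz n o\<^sub>L T)"
    unfolding rec[symmetric]
    by (simp add: p_def E_def cs.diff_right cscaleL_cscaleL ba blinfun_compose_linear
        cscaleL_compose scaleR_left_distrib)
  also have "norm \<dots> \<le> norm (cscaleL J a (E n o\<^sub>L T)) + norm (cscaleL J b (E (n - 1)))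
      + norm ((1 - r\<^sup>2) *\<^sub>R (meanz n o\<^sub>L T))"
    using norm_triangle_ineq4[of "cscaleL J a (E n o\<^sub>L T) - cscaleL J b (E (n - 1))" "(1 - r\<^sup>2) *\<^sub>R (meanz n o\<^sub>L T)"]
      norm_triangle_ineq4[of "cscaleL J a (E n o\<^sub>L T)" "cscaleL J b (E (n - 1))"] by linarith
  also have "norm (cscaleL J a (E n o\<^sub>L T)) \<le> 1 * (\<eta> n * norm T)"
  proof (rule order_trans[OF norm_cscaleL_le], rule mult_mono)
    show "norm (E n o\<^sub>L T) \<le> \<eta> n * norm T"
      by (rule order_trans[OF norm_blinfun_compose mult_right_mono[OF E]]) simp
  qed (use r na in auto)
  also have "norm (cscaleL J b (E (n - 1))) \<le> 1 * \<eta> (n - 1)"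
    by (rule order_trans[OF norm_cscaleL_le], rule mult_mono) (use r nb E in auto)
  also have "norm ((1 - r\<^sup>2) *\<^sub>R (meanz n o\<^sub>L T)) \<le> (1 - r\<^sup>2) * (C * norm T)"
  proof -
    have "norm (meanz n o\<^sub>L T) \<le> C * norm T"
      by (rule order_trans[OF norm_blinfun_compose]) (intro mult_right_mono norm_meanz_le, simp)
    moreover have "0 \<le> 1 - r\<^sup>2" using r by (simp add: power_le_one)
    ultimately show ?thesis by (simp add: mult_left_mono)
  qed
  finally have X: "norm (cscaleL J b p - (p o\<^sub>L T)) \<le> (1 - r\<^sup>2) * C * norm T + \<eta> n * norm T + \<eta> (n - 1)"
    by (simp add: algebra_simps)
  have p: "norm p \<le> K * ((1 - r\<^sup>2) * C * norm T + \<eta> n * norm T + \<eta> (n - 1))"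
    using inner[OF pJ] X K unfolding b_def[symmetric] by (meson mult_left_mono order_trans less_imp_le)
  \<comment> \<open>Dividing 1 - a T by \<open>a\<close> yields 1/a - T, and 1/a is the outer point
    exp (i t) / r. The modulus 1/r of this scalar is the 1/r in the bound.\<close>
  have a': "of_real (1 / r) * exp (\<i> * of_real t) * a = 1"
    using r by (simp add: a_def mult_ac flip: exp_add)
  have "norm (q n) \<le> K * norm (cscaleL J (of_real (1 / r) * exp (\<i> * of_real t)) (q n) - (q n o\<^sub>L T))"
    by (rule outer[OF qJ])
  also have "cscaleL J (of_real (1 / r) * exp (\<i> * of_real t)) (q n) - (q n o\<^sub>L T)
      = cscaleL J (of_real (1 / r) * exp (\<i> * of_real t)) p"
    unfolding p_def cs.diff_right cscaleL_cscaleL a' by simp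
  also have "norm \<dots> \<le> 1 / r * norm p"
    using norm_cscaleL_le[of "of_real (1 / r) * exp (\<i> * of_real t)" p] r by (simp add: norm_mult norm_divide)
  also note p
  finally show ?thesis
    using K r by (simp add: q_def mult_left_mono divide_right_mono mult.assoc)
qed

section \<open>Abel summation and functions vanishing near the spectrum\<close>

lemma poisson_integral:
  assumes h: "continuous_on UNIV h" and fs: "(\<lambda>j. norm (fourier_coeff h j)) summable_on UNIV"
    and r: "0 \<le> r" "r < 1"
  shows "((\<lambda>t. cscaleL J (h t) (meanz_conv (poisson_coeff r t) n)) has_integral
    (2 * pi) *\<^sub>R meanz_conv (\<lambda>j. of_real (r ^ nat \<bar>j\<bar>) * fourier_coeff h j) n) {0..2*pi}"
proof -
  let ?f = "\<lambda>Y t. \<Sum>j\<in>Y. cscaleL J (h t * poisson_coeff r t j) (meanz (n + j))"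
  let ?F = "\<lambda>j. of_real (r ^ nat \<bar>j\<bar>) * fourier_coeff h j"
  have "compact (h ` {0..2*pi})"
    by (intro compact_continuous_image continuous_on_subset[OF h]) auto
  then obtain H where H: "\<And>t. t \<in> {0..2*pi} \<Longrightarrow> norm (h t) \<le> H"
    using compact_imp_bounded bounded_iff by (metis imageI)
  have cont: "continuous_on {0..2*pi} (\<lambda>t. h t * poisson_coeff r t j)" for j
    unfolding poisson_coeff_def by (intro continuous_intros continuous_on_subset[OF h]) auto
  \<comment> \<open>For r < 1 the geometric factors give a majorant independent of \<open>t\<close>,
    hence uniform convergence, and the series may be integrated term by term.\<close>
  have "uniform_limit {0..2*pi} ?f (\<lambda>t. \<Sum>\<^sub>\<infinity>j. cscaleL J (h t * poisson_coeff r t j) (meanz (n + j)))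
      (finite_subsets_at_top UNIV)"
  proof (rule Weierstrass_m_test_general)
    show "norm (cscaleL J (h t * poisson_coeff r t j) (meanz (n + j))) \<le> H * r ^ nat \<bar>j\<bar> * C"
      if "t \<in> {0..2*pi}" for j t
    proof (rule order_trans[OF norm_cscaleL_le], rule mult_mono)
      show "norm (h t * poisson_coeff r t j) \<le> H * r ^ nat \<bar>j\<bar>"
        unfolding norm_mult norm_poisson_coeff[OF r(1)] by (rule mult_right_mono[OF H[OF that]]) (use r in simp)
      show "0 \<le> H * r ^ nat \<bar>j\<bar>"
        using order_trans[OF norm_ge_zero H[OF that]] r by simp
    qed (use norm_meanz_le in auto)
    show "(\<lambda>j. H * r ^ nat \<bar>j\<bar> * C) summable_on UNIV"
      by (intro summable_on_cmult_left summable_on_cmult_right summable_on_int_geometric r)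
  qed
  then obtain I I' where I: "\<And>Y. (?f Y has_integral I Y) {0..2*pi}"
    and I': "((\<lambda>t. \<Sum>\<^sub>\<infinity>j. cscaleL J (h t * poisson_coeff r t j) (meanz (n + j))) has_integral I') {0..2*pi}"
    and lim: "(I \<longlongrightarrow> I') (finite_subsets_at_top UNIV)"
    by (rule uniform_limit_integral) (auto intro!: continuous_on_sum cs.continuous_on cont continuous_on_const)
  have coeff: "((\<lambda>t. h t * poisson_coeff r t j) has_integral of_real (2 * pi) * ?F j) {0..2*pi}" for j
  proof -
    let ?k = "\<lambda>t. h t * exp (- \<i> * of_int j * of_real t)"
    have "?k integrable_on {0..2*pi}"
      by (intro integrable_continuous_interval continuous_intros continuous_on_subset[OF h]) auto
    then have "(?k has_integral of_real (2 * pi) * fourier_coeff h j) {0..2*pi}"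
      by (simp add: fourier_coeff_def has_integral_integral)
    from has_integral_mult_right[OF this, of "of_real (r ^ nat \<bar>j\<bar>)"] show ?thesis
      by (simp add: poisson_coeff_def mult_ac)
  qed
  have "I Y = (\<Sum>j\<in>Y. cscaleL J (of_real (2 * pi) * ?F j) (meanz (n + j)))" if "finite Y" for Y
  proof (rule has_integral_unique[OF I has_integral_sum[OF that]])
    show "((\<lambda>t. cscaleL J (h t * poisson_coeff r t j) (meanz (n + j)))
        has_integral cscaleL J (of_real (2 * pi) * ?F j) (meanz (n + j))) {0..2*pi}" for j
      using has_integral_linear[OF coeff cs.bounded_linear_left] by (simp add: o_def)
  qed
  then have "\<forall>\<^sub>F Y in finite_subsets_at_top UNIV.
      I Y = (\<Sum>j\<in>Y. cscaleL J (of_real (2 * pi) * ?F j) (meanz (n + j)))"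
    by (intro eventually_finite_subsets_at_top_weakI) auto
  moreover have F: "(\<lambda>j. norm (?F j)) summable_on UNIV"
    by (rule summable_on_comparison_test[OF fs])
       (use r in \<open>auto simp: norm_mult norm_power power_le_one intro!: mult_left_le_one_le\<close>)
  have "(\<lambda>j. norm (of_real (2 * pi) * ?F j)) summable_on UNIV"
    unfolding norm_mult[of "of_real (2 * pi)"] by (rule summable_on_cmult_right[OF F])
  from meanz_conv_has_sum[OF this, of n]
  have "((\<lambda>Y. \<Sum>j\<in>Y. cscaleL J (of_real (2 * pi) * ?F j) (meanz (n + j)))
      \<longlongrightarrow> (2 * pi) *\<^sub>R meanz_conv ?F n) (finite_subsets_at_top UNIV)"
    unfolding meanz_conv_cmult[OF F] cscaleL_of_real has_sum_def .
  ultimately have "(I \<longlongrightarrow> (2 * pi) *\<^sub>R meanz_conv ?F n) (finite_subsets_at_top UNIV)"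
    by (simp add: tendsto_cong)
  then have "I' = (2 * pi) *\<^sub>R meanz_conv ?F n"
    using lim by (intro tendsto_unique[OF _ lim]) auto
  moreover have "(\<Sum>\<^sub>\<infinity>j. cscaleL J (h t * poisson_coeff r t j) (meanz (n + j)))
      = cscaleL J (h t) (meanz_conv (poisson_coeff r t) n)" for t
    using meanz_conv_cmult[OF poisson_coeff_summable[OF r, of t], of "h t" n] by (simp add: meanz_conv_def)
  ultimately show ?thesis using I' by simp
qed

text \<open>Two limits are taken in a fixed order. Replacing the coefficients by their Abel damping
  costs \<open>C * \<rho> r\<close>, uniformly in \<open>n\<close>; for fixed r the shift errors
  vanish as \<open>n\<close> grows, leaving \<open>L r\<close>; finally \<rho> and \<open>L\<close>
  tend to 0 as r tends to 1.\<close>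

lemma meanz_conv_vanishing:
  assumes h: "continuous_on UNIV h" and fs: "(\<lambda>j. norm (fourier_coeff h j)) summable_on UNIV"
    and U: "open U" "{t. exp (\<i> * of_real t) \<in> op_spectrum J T} \<subseteq> U" and hU: "\<And>t. t \<in> U \<Longrightarrow> h t = 0"
  shows "(\<lambda>n. meanz_conv (fourier_coeff h) (int n)) \<longlonglongrightarrow> 0"
proof -
  \<comment> \<open>Points of the circle outside \<open>U\<close>, the only ones where
    \<open>h\<close> can be nonzero: a compact set missing the spectrum, so one resolvent constant
    serves for all of it.\<close>
  define Z where "Z = (\<lambda>t. exp (\<i> * of_real t)) ` ({0..2*pi} - U)"
  have "compact Z"
    unfolding Z_def by (intro compact_continuous_image continuous_intros compact_diff U) auto
  moreover have "Z \<inter> op_spectrum J T = {}" using U(2) by (auto simp: Z_def)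
  ultimately obtain \<delta> K where \<delta>: "0 < \<delta>" and K: "0 < K"
    and res: "\<And>w0 w q. w0 \<in> Z \<Longrightarrow> dist w0 w < \<delta> \<Longrightarrow> q o\<^sub>L J = J o\<^sub>L q \<Longrightarrow>
      norm q \<le> K * norm (cscaleL J w q - (q o\<^sub>L T))"
    by (rule resolvent_uniform_bound) blast
  have "compact (h ` {0..2*pi})"
    by (intro compact_continuous_image continuous_on_subset[OF h]) auto
  then obtain H where H: "\<And>t. t \<in> {0..2*pi} \<Longrightarrow> norm (h t) \<le> H"
    using compact_imp_bounded bounded_iff by (metis imageI)
  have H0: "0 \<le> H" using order_trans[OF norm_ge_zero H[of 0]] by simp
  define \<eta> where "\<eta> r n = (\<Sum>\<^sub>\<infinity>j. r ^ nat \<bar>j\<bar> * shift_err (n + j))" for r n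
  define \<rho> where "\<rho> r = (\<Sum>\<^sub>\<infinity>j. norm (fourier_coeff h j) * (1 - r ^ nat \<bar>j\<bar>))" for r
  define B where "B r n = H * (K * K / r * ((1 - r\<^sup>2) * C * norm T + \<eta> r n * norm T + \<eta> r (n - 1)))" for r n
  define L where "L r = H * (K * K / r * ((1 - r\<^sup>2) * C * norm T))" for r
  have bound: "norm (meanz_conv (fourier_coeff h) n) \<le> C * \<rho> r + B r n"
    if r: "0 < r" "r < 1" "\<bar>1 - r\<bar> < \<delta>" "\<bar>1 - 1 / r\<bar> < \<delta>" for r n
  proof -
    let ?F = "\<lambda>j. of_real (r ^ nat \<bar>j\<bar>) * fourier_coeff h j"
    have r': "0 \<le> r" "0 \<le> 1 - r\<^sup>2" using r by (auto simp: power_le_one)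
    have \<eta>: "0 \<le> \<eta> r n" for n
      unfolding \<eta>_def using r by (intro infsum_nonneg) (simp add: shift_err_def)
    have B0: "0 \<le> B r n"
      unfolding B_def using H0 K r r' \<eta> C_nonneg by (intro mult_nonneg_nonneg add_nonneg_nonneg divide_nonneg_nonneg) auto
    have "norm (cscaleL J (h t) (meanz_conv (poisson_coeff r t) n)) \<le> B r n" if t: "t \<in> {0..2*pi}" for t
    proof (cases "t \<in> U")
      case True
      then show ?thesis using B0 by (simp add: hU cs.zero_left)
    next
      case False
      then have Z: "exp (\<i> * of_real t) \<in> Z" using t by (auto simp: Z_def)
      have d: "dist (exp (\<i> * of_real t)) (of_real s * exp (\<i> * of_real t)) = \<bar>1 - s\<bar>" for s
      proof -
        have "exp (\<i> * of_real t) - of_real s * exp (\<i> * of_real t) = of_real (1 - s) * exp (\<i> * of_real t)"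
          by (simp add: algebra_simps)
        then show ?thesis unfolding dist_norm by (simp only: norm_mult norm_of_real) simp
      qed
      have "norm (meanz_conv (poisson_coeff r t) n)
          \<le> K * K / r * ((1 - r\<^sup>2) * C * norm T + \<eta> r n * norm T + \<eta> r (n - 1))"
        unfolding \<eta>_def
        by (rule poisson_bound[OF r(1,2) K]; rule res[OF Z]; simp only: d r)
      then show ?thesis
        unfolding B_def by (rule order_trans[OF norm_cscaleL_le mult_mono[OF H[OF t] _ H0]]) auto
    qed
    \<comment> \<open>The length 2 pi of the interval cancels the factor 2 pi from the Fourier
      coefficients.\<close>
    then have "norm ((2 * pi) *\<^sub>R meanz_conv ?F n) \<le> B r n * measure lborel {0..2*pi}"
      by (intro has_integral_bound_real[OF B0 _ poisson_integral[OF h fs r'(1) r(2)], where S = "{}"]) auto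
    then have D: "norm (meanz_conv ?F n) \<le> B r n" by (simp add: mult_ac)
    have Fs: "(\<lambda>j. norm (?F j)) summable_on UNIV"
      by (rule summable_on_comparison_test[OF fs])
         (use r in \<open>auto simp: norm_mult norm_power power_le_one intro!: mult_left_le_one_le\<close>)
    have nd: "norm (fourier_coeff h j - ?F j) = norm (fourier_coeff h j) * (1 - r ^ nat \<bar>j\<bar>)" for j
    proof -
      have "fourier_coeff h j - ?F j = fourier_coeff h j * of_real (1 - r ^ nat \<bar>j\<bar>)"
        by (simp add: algebra_simps)
      then show ?thesis
        using r by (simp only: norm_mult norm_of_real) (simp add: power_le_one)
    qed
    have "(\<lambda>j. norm (fourier_coeff h j - ?F j)) summable_on UNIV"
      by (rule summable_on_comparison_test[OF summable_on_add[OF fs Fs]]) (auto intro: norm_triangle_ineq4)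
    from norm_meanz_conv_le[OF this, of n]
    have "norm (meanz_conv (fourier_coeff h) n - meanz_conv ?F n) \<le> C * \<rho> r"
      by (simp only: nd meanz_conv_diff[OF fs Fs] \<rho>_def)
    then show ?thesis
      using D norm_triangle_sub[of "meanz_conv (fourier_coeff h) n" "meanz_conv ?F n"] by linarith
  qed
  have B_lim: "(\<lambda>n. C * \<rho> r + B r (int n)) \<longlonglongrightarrow> C * \<rho> r + L r" if r: "0 < r" "r < 1" for r
  proof -
    have \<eta>_lim: "(\<eta> r \<longlongrightarrow> 0) at_top"
      using shift_err_conv_tendsto[OF poisson_coeff_summable[of r 0]] r
      by (simp add: \<eta>_def[abs_def] norm_poisson_coeff)
    have "filterlim (\<lambda>n. int n - 1) at_top sequentially"
      unfolding filterlim_at_top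
    proof
      fix Z :: int
      show "\<forall>\<^sub>F n in sequentially. Z \<le> int n - 1"
        using eventually_ge_at_top[of "nat (Z + 1)"] by eventually_elim linarith
    qed
    from filterlim_compose[OF \<eta>_lim this] filterlim_compose[OF \<eta>_lim filterlim_int_sequentially]
    show ?thesis
      unfolding B_def L_def using r by (auto intro!: tendsto_eq_intros)
  qed
  \<comment> \<open>Radii increasing to 1; the double \<open>Suc\<close> makes the first one 1/2, so
    that dividing by \<open>R m\<close> is always legitimate.\<close>
  define R where "R m = 1 - inverse (real (Suc (Suc m)))" for m
  have R: "0 < R m" "R m < 1" for m by (simp_all add: R_def field_simps)
  have R_lim: "R \<longlonglongrightarrow> 1"
    unfolding R_def using tendsto_diff[OF tendsto_const[of 1] LIMSEQ_Suc[OF LIMSEQ_inverse_real_of_nat]] by simp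
  have \<rho>_lim: "(\<lambda>m. \<rho> (R m)) \<longlonglongrightarrow> 0"
  proof -
    have "(\<lambda>m. \<rho> (R m)) \<longlonglongrightarrow> (\<Sum>\<^sub>\<infinity>j::int. 0)"
      unfolding \<rho>_def
    proof (rule tendsto_infsum_dominated[OF _ _ fs])
      fix j :: int
      have "(\<lambda>m. norm (fourier_coeff h j) * (1 - R m ^ nat \<bar>j\<bar>)) \<longlonglongrightarrow> norm (fourier_coeff h j) * (1 - 1 ^ nat \<bar>j\<bar>)"
        by (intro tendsto_mult tendsto_diff tendsto_power tendsto_const R_lim)
      then show "(\<lambda>m. norm (fourier_coeff h j) * (1 - R m ^ nat \<bar>j\<bar>)) \<longlonglongrightarrow> 0"
        by simp
    next
      show "norm (norm (fourier_coeff h j) * (1 - R m ^ nat \<bar>j\<bar>)) \<le> norm (fourier_coeff h j)" for j m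
        using R[of m] by (simp add: abs_mult power_le_one mult_left_le)
    qed simp
    then show ?thesis by simp
  qed
  have lim: "(\<lambda>m. C * \<rho> (R m) + L (R m)) \<longlonglongrightarrow> 0"
    unfolding L_def by (rule tendsto_eq_intros refl \<rho>_lim R_lim | simp)+
  show ?thesis
  proof (rule tendsto_norm_zero_cancel, rule order_tendstoI)
    fix e :: real assume "0 < e"
    have "(\<lambda>m. \<bar>1 - R m\<bar>) \<longlonglongrightarrow> 0" "(\<lambda>m. \<bar>1 - 1 / R m\<bar>) \<longlonglongrightarrow> 0"
      by (rule tendsto_eq_intros refl R_lim | simp)+
    then have "\<forall>\<^sub>F m in sequentially. \<bar>1 - R m\<bar> < \<delta> \<and> \<bar>1 - 1 / R m\<bar> < \<delta> \<and> C * \<rho> (R m) + L (R m) < e"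
      using \<delta> \<open>0 < e\<close> lim by (intro eventually_conj order_tendstoD(2)) auto
    then obtain m where m: "\<bar>1 - R m\<bar> < \<delta>" "\<bar>1 - 1 / R m\<bar> < \<delta>" "C * \<rho> (R m) + L (R m) < e"
      by (auto dest: eventually_happens)
    have "\<forall>\<^sub>F n in sequentially. C * \<rho> (R m) + B (R m) (int n) < e"
      by (rule order_tendstoD(2)[OF B_lim m(3)]) (use R in auto)
    then show "\<forall>\<^sub>F n in sequentially. norm (meanz_conv (fourier_coeff h) (int n)) < e"
      by eventually_elim (rule le_less_trans[OF bound[OF R m(1,2)]])
  next
    fix e :: real assume "e < 0"
    then show "\<forall>\<^sub>F n in sequentially. e < norm (meanz_conv (fourier_coeff h) (int n))"
      by (intro always_eventually allI) (rule less_le_trans[OF _ norm_ge_zero])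
  qed
qed

lemma meanz_conv_synthesis:
  assumes g: "g \<in> A_alpha \<alpha>"
    and synth: "spectral_synthesis \<alpha> g {t. exp (\<i> * of_real t) \<in> op_spectrum J T}"
  shows "(\<lambda>n. meanz_conv (fourier_coeff g) (int n)) \<longlonglongrightarrow> 0"
proof (rule tendstoI)
  fix e :: real assume e: "0 < e"
  \<comment> \<open>Half of \<open>e\<close> is spent on approximating \<open>g\<close>, with error
    at most C \<epsilon>; using C + 1 avoids dividing by zero when C = 0.\<close>
  define \<epsilon> where "\<epsilon> = e / (2 * (C + 1))"
  have \<epsilon>: "0 < \<epsilon>" using e C_nonneg by (simp add: \<epsilon>_def)
  from synth[unfolded spectral_synthesis_def, rule_format, OF \<epsilon>]
  obtain h U where h: "h \<in> A_alpha \<alpha>" and gh: "A_norm \<alpha> (\<lambda>t. g t - h t) < \<epsilon>"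
    and U: "open U" "{t. exp (\<i> * of_real t) \<in> op_spectrum J T} \<subseteq> U" "\<And>t. t \<in> U \<Longrightarrow> h t = 0"
    by blast
  note gs = A_alpha_fourier_coeff_summable[OF g] and hs = A_alpha_fourier_coeff_summable[OF h]
  have fs: "(\<lambda>n. norm (fourier_coeff g n - fourier_coeff h n)) summable_on UNIV"
    by (rule summable_on_comparison_test[OF summable_on_add[OF gs hs]]) (auto intro: norm_triangle_ineq4)
  have close: "norm (meanz_conv (fourier_coeff g) n - meanz_conv (fourier_coeff h) n) < e / 2" for n
  proof -
    have "norm (meanz_conv (fourier_coeff g) n - meanz_conv (fourier_coeff h) n)
        \<le> C * (\<Sum>\<^sub>\<infinity>n. norm (fourier_coeff g n - fourier_coeff h n))"
      using norm_meanz_conv_le[OF fs, of n] by (simp only: meanz_conv_diff[OF gs hs])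
    also have "\<dots> \<le> C * \<epsilon>"
      using l1_norm_le_A_norm[OF alpha_pos g h] gh by (intro mult_left_mono C_nonneg) simp
    also have "\<dots> < (C + 1) * \<epsilon>" using \<epsilon> by simp
    also have "\<dots> = e / 2" using C_nonneg by (simp add: \<epsilon>_def field_simps)
    finally show ?thesis .
  qed
  have "(\<lambda>n. meanz_conv (fourier_coeff h) (int n)) \<longlonglongrightarrow> 0"
    using h by (intro meanz_conv_vanishing[OF _ hs U]) (auto simp: A_alpha_def)
  then have "\<forall>\<^sub>F n in sequentially. norm (meanz_conv (fourier_coeff h) (int n)) < e / 2"
    using order_tendstoD(2)[OF tendsto_norm_zero, of _ _ "e / 2"] e by simp
  then show "\<forall>\<^sub>F n in sequentially. dist (meanz_conv (fourier_coeff g) (int n)) 0 < e"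
  proof eventually_elim
    case (elim n)
    then show ?case
      using close[of "int n"]
        norm_triangle_sub[of "meanz_conv (fourier_coeff g) (int n)" "meanz_conv (fourier_coeff h) (int n)"]
      by simp
  qed
qed

end

theorem theorem3p4:
  fixes J T :: "'a::banach \<Rightarrow>\<^sub>L 'a" and \<alpha> :: real and g :: "real \<Rightarrow> complex"
  assumes "complex_structure J"
    and "complex_linear_op J T"
    and "\<alpha> > 0"
    and "C_bounded \<alpha> T"
    and "g \<in> A_alpha_plus \<alpha>"
    and "spectral_synthesis \<alpha> g {t. exp (\<i> * of_real t) \<in> op_spectrum J T}"
  shows "(\<lambda>n. norm (cesaro_mean \<alpha> T n o\<^sub>L theta J \<alpha> T (fourier_coeff g))) \<longlonglongrightarrow> 0"
proof -
  obtain C where "\<And>n. norm (cesaro_mean \<alpha> T n) \<le> C"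
    using assms(4) by (auto simp: C_bounded_def)
  then interpret cesaro_bounded_op J T \<alpha> C
    by unfold_locales (use assms in auto)
  have g: "g \<in> A_alpha \<alpha>" and g0: "\<And>n. n < 0 \<Longrightarrow> fourier_coeff g n = 0"
    using assms(5) by (auto simp: A_alpha_plus_def)
  have "(\<lambda>n. kc (\<alpha> + 1) (nat \<bar>n\<bar>) * norm (Wfrac \<alpha> (fourier_coeff g) n)) summable_on UNIV"
    using g by (simp add: A_alpha_def)
  from summable_on_int_nonneg[OF this]
  have "(\<lambda>k. kc (\<alpha> + 1) k * norm (Wp \<alpha> (fourier_coeff g) (int k))) summable_on UNIV"
    by (simp add: Wfrac_def)
  from mean_theta_tendsto[OF A_alpha_fourier_coeff_summable[OF g] g0 this]
  have "(\<lambda>n. (cesaro_mean \<alpha> T n o\<^sub>L theta J \<alpha> T (fourier_coeff g))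
      - meanz_conv (fourier_coeff g) (int n) + meanz_conv (fourier_coeff g) (int n)) \<longlonglongrightarrow> 0 + 0"
    by (rule tendsto_add[OF _ meanz_conv_synthesis[OF g assms(6)]])
  then show ?thesis
    by (intro tendsto_norm_zero) simp
qed

end
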